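(* Let $A\in\mathbb{R}^{n\times n}$ be symmetric positive definite with eigenvalues $\lambda_1\ge\cdots\ge\lambda_n$, let $1\le p<n$, and assume $\delta=\lambda_p-\lambda_{p+1}>0$. Let $L=\lambda_1-\lambda_n$ and $c_Q=2/\pi^2$. Let $V_\alpha\in\mathbb{R}^{n\times p}$ have orthonormal columns spanning the invariant subspace of $A$ associated with $\lambda_1,\dots,\lambda_p$, and let $\phi^*=\phi(V_\alpha)$. If $X_0\in\mathbb{R}^{n\times p}$ satisfies $X_0^TX_0=I$ and $$\mathrm{dist}(X_0,V_\alpha)\le\sqrt{\frac{2c_Q\delta}{L}},$$ then the iterates $X_k$ of Riemannian gradient descent with exact line search started at $X_0$ satisfy $$\phi(X_k)-\phi^*\le\left(1-c_Q\frac{2\delta}{5L}\right)^k(\phi(X_0)-\phi^* )\qquad\text{for all }k\ge 0.$$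
   Context: For $X\in\mathbb{R}^{n\times p}$ with $X^TX=I$, set $\phi(X)=-\tfrac12\mathrm{Tr}(X^TAX)$; it depends only on the column span of $X$, and $\phi^*=\phi(V_\alpha)$ is its minimum. The Riemannian gradient (on the Grassmann manifold) is $\mathrm{grad}\,\phi(X)=-(I-XX^T)AX=-(AX-X(X^TAX))$. Distance: for $X,Y\in\mathbb{R}^{n\times p}$ with orthonormal columns, the principal angles $0\le\theta_1\le\cdots\le\theta_p\le\pi/2$ between their spans are defined by letting $\cos\theta_1,\dots,\cos\theta_p$ be the singular values of $Y^TX$, and $\mathrm{dist}(X,Y)=\sqrt{\theta_1^2+\cdots+\theta_p^2}$. Riemannian gradient descent with exact line search: given $X_k$ with $X_k^TX_k=I$, let $G=\mathrm{grad}\,\phi(X_k)$ and, for $\mu\ge0$, let $X(\mu)=(X_k-\mu G)(I+\mu^2G^TG)^{-1/2}$ (the orthonormal polar factor of $X_k-\mu G$). Let $\mu_{opt}$ be a minimizer of $\mu\mapsto\phi(X(\mu))$ over $\mu\ge0$, and set $X_{k+1}=X(\mu_{opt})$ (if $G=0$ then $X_{k+1}=X_k$). *)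

theory Defs
  imports "HOL-Analysis.Analysis" "HOL-Computational_Algebra.Polynomial"
begin

definition sym_pos_def :: "real^'n^'n \<Rightarrow> bool" where
  "sym_pos_def A \<longleftrightarrow> transpose A = A \<and> (\<forall>x. x \<noteq> 0 \<longrightarrow> x \<bullet> (A *v x) > 0)"

definition charpoly :: "real^'n^'n \<Rightarrow> real poly" where
  "charpoly A = det (mat [:0, 1:] - (\<chi> i j. [:A $ i $ j:]))"

text \<open>Real eigenvalues, counted with algebraic multiplicity.\<close>

definition eigenvalues :: "real^'n^'n \<Rightarrow> real multiset" where
  "eigenvalues A = proots (charpoly A)"

text \<open>The square roots of the eigenvalues of \<open>M\<^sup>T M\<close>, so there are as many as \<open>M\<close> has
  columns.\<close>

definition singular_values :: "real^'p^'m \<Rightarrow> real multiset" where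
  "singular_values M = image_mset sqrt (eigenvalues (transpose M ** M))"

definition orthonormal_columns :: "real^'p^'n \<Rightarrow> bool" where
  "orthonormal_columns X \<longleftrightarrow> transpose X ** X = mat 1"

definition principal_angles :: "real^'p^'n \<Rightarrow> real^'p^'n \<Rightarrow> real list" where
  "principal_angles X Y =
     sorted_list_of_multiset (image_mset arccos (singular_values (transpose Y ** X)))"

definition grassmann_dist :: "real^'p^'n \<Rightarrow> real^'p^'n \<Rightarrow> real" where
  "grassmann_dist X Y = sqrt (\<Sum>\<theta>\<leftarrow>principal_angles X Y. \<theta>\<^sup>2)"

definition \<phi> :: "real^'n^'n \<Rightarrow> real^'p^'n \<Rightarrow> real" where
  "\<phi> A X = - (1/2) * trace (transpose X ** A ** X)"

definition grad_\<phi> :: "real^'n^'n \<Rightarrow> real^'p^'n \<Rightarrow> real^'p^'n" where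
  "grad_\<phi> A X = - ((mat 1 - X ** transpose X) ** A ** X)"

text \<open>Symmetric positive definite square root; only meaningful when \<open>B\<close> is itself
  symmetric positive definite, in which case it exists and is unique.\<close>

definition spd_sqrt :: "real^'p^'p \<Rightarrow> real^'p^'p" where
  "spd_sqrt B = (THE S. sym_pos_def S \<and> S ** S = B)"

definition line_point :: "real^'n^'n \<Rightarrow> real^'p^'n \<Rightarrow> real \<Rightarrow> real^'p^'n" where
  "line_point A X \<mu> =
     (let G = grad_\<phi> A X
      in (X - \<mu> *\<^sub>R G) ** matrix_inv (spd_sqrt (mat 1 + \<mu>\<^sup>2 *\<^sub>R (transpose G ** G))))"

text \<open>A relation rather than a function, because the minimizing step size need not be unique:
  every minimizer is an admissible choice.\<close>

definition rgd_step :: "real^'n^'n \<Rightarrow> real^'p^'n \<Rightarrow> real^'p^'n \<Rightarrow> bool" where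
  "rgd_step A X X' \<longleftrightarrow>
     (if grad_\<phi> A X = 0 then X' = X
      else \<exists>\<mu>opt\<ge>0. (\<forall>\<mu>\<ge>0. \<phi> A (line_point A X \<mu>opt) \<le> \<phi> A (line_point A X \<mu>)) \<and>
             X' = line_point A X \<mu>opt)"

definition rgd_iterates :: "real^'n^'n \<Rightarrow> real^'p^'n \<Rightarrow> (nat \<Rightarrow> real^'p^'n) \<Rightarrow> bool" where
  "rgd_iterates A X0 X \<longleftrightarrow> X 0 = X0 \<and> (\<forall>k. rgd_step A (X k) (X (Suc k)))"

definition c_Q :: real where
  "c_Q = 2 / pi\<^sup>2"

end

theory Submission
  imports Defs
begin

text \<open>Let \<open>s\<close> be the sum of the squared sines of the principal angles between \<open>X\<close> and \<open>V\<^sub>\<alpha>\<close>,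
  i.e. the squared Frobenius norm of \<open>X - V\<^sub>\<alpha>V\<^sub>\<alpha>\<^sup>TX\<close>, and let \<open>f = \<phi>(X) - \<phi>*\<close>. Splitting the quadratic form
  of \<open>A\<close> along the invariant subspace gives \<open>\<delta> s \<le> 2 f \<le> L s\<close>. Pairing the gradient \<open>G\<close> with the tangent
  vector \<open>V\<^sub>\<alpha> (X\<^sup>T V\<^sub>\<alpha>)\<^sup>-\<^sup>1 - X\<close>, whose squared norm is at most \<open>s / (1 - s)\<close>, gives exactly \<open>-2 f\<close>, so
  Cauchy-Schwarz yields \<open>\<parallel>G\<parallel>\<^sup>2 \<ge> 2 \<delta> (1 - s) f\<close>. The step size \<open>1 / L\<close> already decreases \<open>\<phi>\<close> by
  \<open>2 / (5 L) \<parallel>G\<parallel>\<^sup>2\<close>, because the spectral norm of \<open>G\<close> is at most \<open>L / 2\<close>. The bound on the initial distance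
  means \<open>f \<le> c\<^sub>Q \<delta>\<close>, which persists by monotonicity and keeps \<open>s \<le> 2 c\<^sub>Q\<close>, and then
  \<open>2 (1 - s) \<ge> c\<^sub>Q\<close>.\<close>

section \<open>Spectral theorem for self-adjoint maps and symmetric matrices\<close>

text \<open>The Rayleigh quotient attains its maximum on the compact unit sphere of
  \<open>U\<close>, and a first-order perturbation of a maximizer shows that it is an eigenvector.
  Stating this for invariant subspaces lets it serve both the induction for eigenbases and the
  extremal eigenvalues on a subspace and on its complement.\<close>

lemma selfadjoint_max_eigenvector:
  fixes f :: "'a::euclidean_space \<Rightarrow> 'a"
  assumes f: "linear f" and sa: "\<And>x y. f x \<bullet> y = x \<bullet> f y"
    and U: "subspace U" "f ` U \<subseteq> U" "U \<noteq> {0}"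
  obtains v m where "v \<in> U" "norm v = 1" "f v = m *\<^sub>R v" "\<And>x. x \<in> U \<Longrightarrow> x \<bullet> f x \<le> m * (x \<bullet> x)"
proof -
  let ?K = "sphere 0 1 \<inter> U"
  obtain u where u: "u \<in> U" "u \<noteq> 0"
    using U subspace_0 by blast
  have "compact ?K"
    using closed_subspace[OF U(1)] by (simp add: compact_Int_closed)
  moreover have "(1 / norm u) *\<^sub>R u \<in> ?K"
    using u U(1) by (simp add: subspace_scale)
  hence "?K \<noteq> {}" by blast
  moreover have "continuous_on ?K (\<lambda>x. x \<bullet> f x)"
    using f by (intro continuous_intros linear_continuous_on) (simp add: linear_linear)
  ultimately obtain v where v: "v \<in> ?K" "\<And>y. y \<in> ?K \<Longrightarrow> y \<bullet> f y \<le> v \<bullet> f v"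
    using continuous_attains_sup by meson
  define m where "m = v \<bullet> f v"
  have le: "x \<bullet> f x \<le> m * (x \<bullet> x)" if "x \<in> U" for x
  proof (cases "x = 0")
    case False
    have "(1 / norm x) *\<^sub>R x \<in> ?K"
      using that False U(1) by (simp add: subspace_scale)
    from v(2)[OF this] have "(x \<bullet> f x) / (norm x)\<^sup>2 \<le> m"
      using f by (simp add: m_def linear_scale power2_eq_square)
    with False show ?thesis
      by (simp add: field_simps power2_norm_eq_inner)
  qed (simp add: f linear_0)
  have vv: "v \<bullet> v = 1"
    using v(1) by (simp add: norm_eq_1)
  \<comment> \<open>The residual of the eigenvalue equation is itself an admissible direction, since
    \<open>U\<close> is invariant. Along \<open>v + t w\<close> the nonnegative form
    \<open>m (x \<bullet> x) - x \<bullet> f x\<close> has constant term 0 and linear coefficient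
    \<open>2 (w \<bullet> w)\<close>, which must therefore vanish.\<close>
  define w where "w = m *\<^sub>R v - f v"
  have wU: "w \<in> U"
    using U(1,2) v(1) by (auto simp: w_def intro!: subspace_diff subspace_scale)
  define q where "q = m * (w \<bullet> w) - w \<bullet> f w"
  have q: "0 \<le> 2 * t * (w \<bullet> w) + t\<^sup>2 * q" for t
  proof -
    have "v + t *\<^sub>R w \<in> U"
      using U(1) v(1) wU by (auto intro!: subspace_add subspace_scale)
    from le[OF this] have "0 \<le> m * ((v + t *\<^sub>R w) \<bullet> (v + t *\<^sub>R w)) - (v + t *\<^sub>R w) \<bullet> f (v + t *\<^sub>R w)"
      by simp
    also have "v \<bullet> f w = w \<bullet> f v"
      using sa by (metis inner_commute)
    hence "m * ((v + t *\<^sub>R w) \<bullet> (v + t *\<^sub>R w)) - (v + t *\<^sub>R w) \<bullet> f (v + t *\<^sub>R w)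
       = 2 * t * (w \<bullet> (m *\<^sub>R v - f v)) + t\<^sup>2 * q"
      using f vv
      by (simp add: linear_add linear_scale inner_simps q_def m_def[symmetric]
          inner_commute[of w v] algebra_simps power2_eq_square)
    finally show ?thesis by (simp add: w_def)
  qed
  have "q \<ge> 0"
    using le[OF wU] by (simp add: q_def)
  have "w \<bullet> w = 0"
  proof (rule ccontr)
    assume "w \<bullet> w \<noteq> 0"
    hence pos: "w \<bullet> w > 0" by simp
    \<comment> \<open>The quadratic in \<open>t\<close> would be minimal at
      \<open>- (w \<bullet> w) / q\<close>; the added 1 keeps the denominator positive when
      \<open>q = 0\<close>, and the value is still negative.\<close>
    define t where "t = - (w \<bullet> w) / (q + 1)"
    have "t \<noteq> 0" and w: "w \<bullet> w = - t * (q + 1)"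
      using pos \<open>q \<ge> 0\<close> by (auto simp: t_def)
    have "2 * t * (w \<bullet> w) + t\<^sup>2 * q = - (t\<^sup>2 * (q + 2))"
      unfolding w by (simp add: algebra_simps power2_eq_square)
    moreover have "t\<^sup>2 * (q + 2) > 0"
      using \<open>q \<ge> 0\<close> \<open>t \<noteq> 0\<close> by simp
    ultimately show False using q[of t] by linarith
  qed
  hence "f v = m *\<^sub>R v" by (simp add: w_def)
  with v(1) le show ?thesis by (intro that) auto
qed

text \<open>Induction on the dimension: split off a unit eigenvector; by self-adjointness its
  orthogonal complement within \<open>U\<close> is again invariant.\<close>

lemma selfadjoint_eigenbasis:
  fixes f :: "'a::euclidean_space \<Rightarrow> 'a"
  assumes f: "linear f" and sa: "\<And>x y. f x \<bullet> y = x \<bullet> f y"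
    and "subspace U" "f ` U \<subseteq> U"
  shows "\<exists>B. B \<subseteq> U \<and> pairwise orthogonal B \<and> U \<subseteq> span B \<and>
           (\<forall>b\<in>B. norm b = 1 \<and> (\<exists>m. f b = m *\<^sub>R b))"
  using assms(3,4)
proof (induction "dim U" arbitrary: U rule: less_induct)
  case less
  show ?case
  proof (cases "U = {0}")
    case False
    obtain v m where v: "v \<in> U" "norm v = 1" "f v = m *\<^sub>R v"
      using selfadjoint_max_eigenvector[OF f sa less.prems False] by blast
    have vv: "v \<bullet> v = 1" using v(2) by (simp add: norm_eq_1)
    define W where "W = U \<inter> {x. v \<bullet> x = 0}"
    have W: "subspace W"
      unfolding W_def by (intro subspace_inter less.prems subspace_hyperplane)
    have "v \<bullet> f x = 0" if "v \<bullet> x = 0" for x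
      using sa[of v x] that v(3) by simp
    hence fW: "f ` W \<subseteq> W"
      using less.prems by (auto simp: W_def)
    have "v \<notin> W" using vv by (simp add: W_def)
    moreover have "W \<subseteq> U" by (simp add: W_def)
    ultimately have "W \<subset> U" using v(1) by auto
    hence "dim W < dim U"
      using W less.prems(1) by (metis dim_psubset span_eq_iff)
    from less.hyps[OF this W fW] obtain B where B: "B \<subseteq> W" "pairwise orthogonal B" "W \<subseteq> span B"
      "\<forall>b\<in>B. norm b = 1 \<and> (\<exists>m. f b = m *\<^sub>R b)" by blast
    have "pairwise orthogonal (insert v B)"
      using B(1,2) by (auto simp: pairwise_insert orthogonal_def W_def inner_commute)
    moreover have "U \<subseteq> span (insert v B)"
    proof
      fix x assume x: "x \<in> U"
      have "x - (v \<bullet> x) *\<^sub>R v \<in> W"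
        using x v(1) less.prems(1) vv
        by (auto simp: W_def inner_diff_right intro!: subspace_diff subspace_scale)
      thus "x \<in> span (insert v B)"
        using B(3) by (auto simp: span_insert)
    qed
    moreover have "insert v B \<subseteq> U" using B(1) v(1) by (auto simp: W_def)
    ultimately show ?thesis using B(4) v(2,3) by blast
  qed (auto intro: exI[of _ "{}"])
qed

lemma inner_transpose_matrix_vector:
  fixes A :: "real^'n^'m"
  shows "(A *v x) \<bullet> y = x \<bullet> (transpose A *v y)"
  by (metis dot_lmul_matrix inner_commute transpose_matrix_vector)

definition diag_matrix :: "('n \<Rightarrow> 'a::zero) \<Rightarrow> 'a^'n^'n" where
  "diag_matrix d = (\<chi> i j. if i = j then d i else 0)"

text \<open>An orthonormal eigenbasis has exactly \<open>CARD('n)\<close> elements, so the index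
  type itself can enumerate it; the enumerated vectors are the columns of \<open>Q\<close>.\<close>

theorem symmetric_matrix_diagonalization:
  fixes A :: "real^'n^'n"
  assumes A: "transpose A = A"
  obtains Q :: "real^'n^'n" and d where "transpose Q ** Q = mat 1" "Q ** transpose Q = mat 1"
    "A = Q ** diag_matrix d ** transpose Q"
proof -
  have sa: "(A *v x) \<bullet> y = x \<bullet> (A *v y)" for x y
    using inner_transpose_matrix_vector[of A] A by simp
  obtain B where B: "pairwise orthogonal B" "UNIV \<subseteq> span B"
      "\<forall>b\<in>B. norm b = 1 \<and> (\<exists>m. A *v b = m *\<^sub>R b)"
    using selfadjoint_eigenbasis[of "(*v) A" UNIV] sa by auto
  have ind: "independent B"
    using B(1,3) by (intro pairwise_orthogonal_independent) auto
  have "card B = dim (UNIV :: (real^'n) set)"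
    using B(2) ind by (intro basis_card_eq_dim) auto
  hence "card B = CARD('n)" by simp
  moreover have "finite B" using ind by (rule independent_imp_finite)
  ultimately obtain b where b: "bij_betw b (UNIV::'n set) B"
    by (metis finite finite_same_card_bij)
  have bB: "b i \<in> B" for i using b by (auto simp: bij_betw_def)
  have bij: "b i \<bullet> b j = (if i = j then 1 else 0)" for i j
  proof (cases "i = j")
    case True thus ?thesis using B(3) bB by (simp add: norm_eq_1)
  next
    case False
    hence "b i \<noteq> b j" using b by (auto simp: bij_betw_def inj_on_def)
    thus ?thesis using B(1) bB False by (auto simp: pairwise_def orthogonal_def)
  qed
  have "\<forall>i. \<exists>m. A *v b i = m *\<^sub>R b i"
    using B(3) bB by auto
  from choice[OF this] obtain d where d: "\<forall>i. A *v b i = d i *\<^sub>R b i" ..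
  define Q where "Q = (\<chi> i j. b j $ i)"
  have QQ: "transpose Q ** Q = mat 1"
    using bij by (simp add: Q_def matrix_matrix_mult_def transpose_def mat_def inner_vec_def vec_eq_iff)
  hence QQ': "Q ** transpose Q = mat 1"
    by (simp add: matrix_left_right_inverse)
  have "A ** Q = Q ** diag_matrix d"
  proof -
    have "(A *v b j) $ i = b j $ i * d j" for i j by (simp add: d)
    thus ?thesis
      by (simp add: vec_eq_iff matrix_matrix_mult_def matrix_vector_mult_def Q_def diag_matrix_def
          if_distrib[of "(*) _"] cong: if_cong)
  qed
  hence "A ** (Q ** transpose Q) = Q ** diag_matrix d ** transpose Q"
    by (simp add: matrix_mul_assoc)
  with QQ QQ' that[of Q d] show ?thesis by simp
qed

lemma diag_matrix_mult:
  fixes d e :: "'n::finite \<Rightarrow> 'a::semiring_1"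
  shows "diag_matrix d ** diag_matrix e = diag_matrix (\<lambda>i. d i * e i)"
  by (simp add: vec_eq_iff matrix_matrix_mult_def diag_matrix_def
      if_distrib[of "(*) _"] if_distrib[of "\<lambda>x. x * _"] cong: if_cong)

lemma transpose_diag_matrix [simp]: "transpose (diag_matrix d) = diag_matrix d"
  by (simp add: vec_eq_iff transpose_def diag_matrix_def)

section \<open>Characteristic polynomials and eigenvalue multisets\<close>

lemma poly_det: "poly (det M) x = det (\<chi> i j. poly (M $ i $ j) x)"
  by (simp add: det_def poly_sum poly_prod)

lemma poly_charpoly: "poly (charpoly A) x = det (mat x - A)"
  unfolding charpoly_def poly_det
  by (rule arg_cong[of _ _ det]) (simp add: vec_eq_iff mat_def)

lemma matrix_diff_ldistrib: "(A :: 'a::ring_1^'n^'m) ** (B - C) = A ** B - A ** C"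
  by (simp add: vec_eq_iff matrix_matrix_mult_def sum_subtractf algebra_simps)

lemma matrix_diff_rdistrib: "(A - B) ** (C :: 'a::ring_1^'n^'m) = A ** C - B ** C"
  by (simp add: vec_eq_iff matrix_matrix_mult_def sum_subtractf algebra_simps)

lemma mat_matrix_mult_commute: "mat x ** M = M ** mat (x::'a::comm_semiring_1)"
  by (simp add: vec_eq_iff matrix_matrix_mult_def mat_def
      if_distrib[of "(*) _"] if_distrib[of "\<lambda>x. x * _"] mult.commute cong: if_cong)

text \<open>The orthogonal conjugation cancels in the determinant, so at every point the
  characteristic polynomial agrees with a product of linear factors, whose roots can be read off
  with multiplicity.\<close>

lemma eigenvalues_diagonalized:
  fixes Q :: "real^'n^'n"
  assumes "Q ** transpose Q = mat 1"
  shows "eigenvalues (Q ** diag_matrix d ** transpose Q) = image_mset d (mset_set UNIV)"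
proof -
  have "poly (charpoly (Q ** diag_matrix d ** transpose Q)) x = poly (\<Prod>i\<in>UNIV. [:- d i, 1:]) x" for x
  proof -
    have "mat x - Q ** diag_matrix d ** transpose Q
       = Q ** (mat x - diag_matrix d) ** transpose Q"
    proof -
      have "Q ** mat x ** transpose Q = mat x ** (Q ** transpose Q)"
        by (simp only: mat_matrix_mult_commute[symmetric] matrix_mul_assoc)
      thus ?thesis
        using assms by (simp add: matrix_diff_ldistrib matrix_diff_rdistrib)
    qed
    hence "poly (charpoly (Q ** diag_matrix d ** transpose Q)) x
       = det (Q ** transpose Q) * det (mat x - diag_matrix d)"
      by (simp add: poly_charpoly det_mul)
    also have "det (mat x - diag_matrix d) = (\<Prod>i\<in>UNIV. x - d i)"
      by (subst det_diagonal) (auto simp: mat_def diag_matrix_def)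
    finally show ?thesis using assms by (simp add: poly_prod)
  qed
  hence "charpoly (Q ** diag_matrix d ** transpose Q) = (\<Prod>i\<in>UNIV. [:- d i, 1:])"
    by (intro iffD1[OF poly_eq_poly_eq_iff] ext)
  thus ?thesis
    by (simp add: eigenvalues_def proots_prod sum_unfold_sum_mset)
qed

text \<open>A singular \<open>mat m - A\<close> makes \<open>m\<close> a root. The nonemptiness
  assumption gives that the characteristic polynomial is nonzero, as \<open>proots 0\<close> is
  empty by convention.\<close>

lemma eigenvalue_in_eigenvalues:
  assumes "A *v v = m *\<^sub>R v" "v \<noteq> 0" "eigenvalues A \<noteq> {#}"
  shows "m \<in># eigenvalues A"
proof -
  have "(mat m - A) *v v = 0"
  proof -
    have "mat m *v v = m *\<^sub>R v"
      by (simp add: vec_eq_iff matrix_vector_mult_def mat_def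
          if_distrib[of "\<lambda>x. x * _"] cong: if_cong)
    thus ?thesis using assms(1) by (simp add: matrix_vector_mult_diff_rdistrib)
  qed
  hence "\<not> invertible (mat m - A)"
    using assms(2) by (auto simp: invertible_left_inverse matrix_left_invertible_ker)
  hence "poly (charpoly A) m = 0"
    by (simp add: poly_charpoly invertible_det_nz)
  moreover have "charpoly A \<noteq> 0"
    using assms(3) by (auto simp: eigenvalues_def)
  ultimately show ?thesis by (simp add: eigenvalues_def)
qed

section \<open>Frobenius inner product and quadratic forms\<close>

text \<open>The inner product of the nested vector type is the Frobenius product. This is how the
  traces in the objective become inner products.\<close>

lemma trace_transpose_mult:
  fixes X Y :: "real^'p^'n"
  shows "trace (transpose X ** Y) = X \<bullet> Y"
proof -
  have "trace (transpose X ** Y) = (\<Sum>j\<in>UNIV. \<Sum>i\<in>UNIV. X $ i $ j * Y $ i $ j)"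
    by (simp add: trace_def transpose_def matrix_matrix_mult_def)
  also have "\<dots> = X \<bullet> Y"
    by (subst sum.swap) (simp add: inner_vec_def)
  finally show ?thesis .
qed

lemma inner_matrix_mult_left:
  fixes A :: "real^'m^'n"
  shows "(A ** X) \<bullet> Y = X \<bullet> (transpose A ** Y)"
  by (simp add: trace_transpose_mult[symmetric] matrix_transpose_mul matrix_mul_assoc)

lemma inner_matrix_mult_right:
  fixes X :: "real^'m^'n"
  shows "(X ** B) \<bullet> Y = X \<bullet> (Y ** transpose B)"
proof -
  have "(X ** B) \<bullet> Y = trace (transpose B ** (transpose X ** Y))"
    by (simp add: trace_transpose_mult[symmetric] matrix_transpose_mul matrix_mul_assoc)
  also have "\<dots> = trace (transpose X ** Y ** transpose B)"
    by (rule trace_mul_sym)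
  also have "\<dots> = X \<bullet> (Y ** transpose B)"
    by (simp add: trace_transpose_mult[symmetric] matrix_mul_assoc)
  finally show ?thesis .
qed

lemma inner_transpose:
  fixes X Y :: "real^'p^'n"
  shows "transpose X \<bullet> transpose Y = X \<bullet> Y"
  using trace_mul_sym[of X "transpose Y"]
  by (simp add: trace_transpose_mult[symmetric] inner_commute[of "transpose X"])
     (simp add: trace_transpose_mult inner_commute)

lemma inner_columns:
  fixes X Y :: "real^'p^'n"
  shows "X \<bullet> Y = (\<Sum>j\<in>UNIV. column j X \<bullet> column j Y)"
  unfolding inner_vec_def column_def by simp (rule sum.swap)

lemma column_matrix_mult: "column j (A ** X) = A *v column j X"
  by (simp add: vec_eq_iff column_def matrix_matrix_mult_def matrix_vector_mult_def)

text \<open>The Frobenius product is a sum over columns, so a bound on a vector quadratic form lifts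
  to matrices column by column.\<close>

lemma quadratic_form_columns_le:
  fixes Z :: "real^'p^'n"
  assumes "\<And>j. column j Z \<bullet> (M *v column j Z) \<le> c * (column j Z \<bullet> column j Z)"
  shows "Z \<bullet> (M ** Z) \<le> c * (Z \<bullet> Z)"
  using assms by (simp add: inner_columns column_matrix_mult sum_distrib_left sum_mono)

lemma quadratic_form_columns_ge:
  fixes Z :: "real^'p^'n"
  assumes "\<And>j. c * (column j Z \<bullet> column j Z) \<le> column j Z \<bullet> (M *v column j Z)"
  shows "c * (Z \<bullet> Z) \<le> Z \<bullet> (M ** Z)"
  using assms by (simp add: inner_columns column_matrix_mult sum_distrib_left sum_mono)

text \<open>Transposition turns multiplication by \<open>M\<close> from the right into
  multiplication from the left, which makes the columnwise bounds available for the rows of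
  \<open>Z\<close>.\<close>

lemma quadratic_form_rows:
  fixes Z :: "real^'p^'n"
  assumes "transpose M = M"
  shows "(Z ** M) \<bullet> Z = transpose Z \<bullet> (M ** transpose Z)"
  using inner_transpose[of "Z ** M" Z] assms
  by (simp add: matrix_transpose_mul inner_commute)

text \<open>The spectral norm is at most the Frobenius norm, by Cauchy-Schwarz in each row.\<close>

lemma norm_matrix_vector_le_frobenius:
  fixes R :: "real^'p^'n"
  shows "(R *v u) \<bullet> (R *v u) \<le> (R \<bullet> R) * (u \<bullet> u)"
proof -
  have "(R *v u) \<bullet> (R *v u) = (\<Sum>i\<in>UNIV. (R $ i \<bullet> u)\<^sup>2)"
    by (simp add: matrix_mult_dot inner_vec_def power2_eq_square)
  also have "\<dots> \<le> (\<Sum>i\<in>UNIV. (R $ i \<bullet> R $ i) * (u \<bullet> u))"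
    by (intro sum_mono Cauchy_Schwarz_ineq)
  finally show ?thesis by (simp add: inner_vec_def sum_distrib_right)
qed

lemma quadratic_form_mult:
  fixes A :: "real^'n^'n" and X :: "real^'p^'n"
  shows "y \<bullet> ((transpose X ** A ** X) *v y) = (X *v y) \<bullet> (A *v (X *v y))"
proof -
  have "(X *v y) \<bullet> (A *v (X *v y)) = y \<bullet> (transpose X *v (A *v (X *v y)))"
    by (rule inner_transpose_matrix_vector)
  thus ?thesis by (simp only: matrix_vector_mul_assoc matrix_mul_assoc)
qed

lemma orthonormal_columns_inner:
  assumes "orthonormal_columns X"
  shows "(X *v y) \<bullet> (X *v z) = y \<bullet> z"
proof -
  have "(X *v y) \<bullet> (X *v z) = y \<bullet> (transpose X *v (X *v z))"
    by (rule inner_transpose_matrix_vector)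
  thus ?thesis using assms unfolding orthonormal_columns_def
    by (simp only: matrix_vector_mul_assoc matrix_vector_mul_lid)
qed

lemma orthonormal_columns_mult_inner:
  assumes "orthonormal_columns X"
  shows "(X ** Y) \<bullet> (X ** Z) = Y \<bullet> Z"
  using assms unfolding orthonormal_columns_def
  by (simp add: inner_matrix_mult_left matrix_mul_assoc)

lemma inner_mat_1: "(mat 1 :: real^'p^'p) \<bullet> mat 1 = CARD('p)"
  using trace_transpose_mult[of "mat 1 :: real^'p^'p" "mat 1"] by (simp add: trace_I)

lemma orthonormal_columns_inner_self:
  fixes X :: "real^'p^'n"
  assumes "orthonormal_columns X"
  shows "X \<bullet> X = CARD('p)"
  using orthonormal_columns_mult_inner[OF assms, of "mat 1" "mat 1"] by (simp add: inner_mat_1)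

section \<open>The objective and its gradient\<close>

lemma \<phi>_eq_inner: "\<phi> A X = - (X \<bullet> (A ** X)) / 2"
  by (simp add: \<phi>_def trace_transpose_mult[symmetric] matrix_mul_assoc)

lemma grad_\<phi>_eq: "grad_\<phi> A X = X ** (transpose X ** A ** X) - A ** X"
  by (simp add: grad_\<phi>_def matrix_diff_rdistrib matrix_mul_assoc)

lemma transpose_diff: "transpose (A - B) = transpose A - transpose B"
  by (simp add: vec_eq_iff transpose_def)

lemma transpose_add: "transpose (A + B) = transpose A + transpose B"
  by (simp add: vec_eq_iff transpose_def)

text \<open>Horizontality of the gradient. It removes the cross terms from the Gram matrix of
  \<open>X - \<mu> G\<close>, leaving the matrix under the root in
  \<open>line_point\<close>.\<close>

lemma orthogonal_grad_\<phi>: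
  assumes "orthonormal_columns X"
  shows "transpose X ** grad_\<phi> A X = 0"
  using assms by (simp add: grad_\<phi>_eq matrix_diff_ldistrib matrix_mul_assoc orthonormal_columns_def)

section \<open>Square roots of positive definite matrices\<close>

lemma sym_pos_def_invertible: "sym_pos_def S \<Longrightarrow> invertible S"
  by (force simp: sym_pos_def_def invertible_left_inverse matrix_left_invertible_ker)

text \<open>The difference \<open>E = S - T\<close> satisfies \<open>S E + E T = 0\<close>. Testing
  this on an eigenvector of \<open>E\<close> forces its eigenvalue to be 0 by positivity of
  \<open>S\<close> and \<open>T\<close>, and a symmetric matrix with only zero eigenvalues
  vanishes.\<close>

lemma sym_pos_def_sqrt_unique:
  fixes S T :: "real^'n^'n"
  assumes S: "sym_pos_def S" and T: "sym_pos_def T" and eq: "S ** S = T ** T"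
  shows "S = T"
proof -
  define E where "E = S - T"
  have symE: "transpose E = E"
    using S T by (simp add: E_def sym_pos_def_def transpose_diff)
  have "S ** E + E ** T = 0"
    using eq by (simp add: E_def matrix_diff_ldistrib matrix_diff_rdistrib)
  hence SE: "S *v (E *v v) + E *v (T *v v) = 0" for v
    by (metis matrix_vector_mul_assoc matrix_vector_mult_add_rdistrib matrix_vector_mult_0)
  have "m = 0" if "E *v v = m *\<^sub>R v" "v \<noteq> 0" for v m
  proof -
    have "v \<bullet> (E *v (T *v v)) = m * (v \<bullet> (T *v v))"
      using inner_transpose_matrix_vector[of E v "T *v v"] symE that(1) by simp
    moreover have "v \<bullet> (S *v (E *v v)) = m * (v \<bullet> (S *v v))"
      by (simp add: that(1) matrix_vector_mult_scaleR)
    ultimately have "m * (v \<bullet> (S *v v) + v \<bullet> (T *v v)) = v \<bullet> (S *v (E *v v) + E *v (T *v v))"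
      by (simp add: inner_add_right algebra_simps)
    moreover have "v \<bullet> (S *v v) + v \<bullet> (T *v v) > 0"
      using S T \<open>v \<noteq> 0\<close> by (auto simp: sym_pos_def_def intro: add_pos_pos)
    ultimately show "m = 0" by (simp add: SE)
  qed
  moreover obtain Q :: "real^'n^'n" and d where Q: "transpose Q ** Q = mat 1" "E = Q ** diag_matrix d ** transpose Q"
    using symmetric_matrix_diagonalization[OF symE] by blast
  ultimately have d0: "d i = 0" for i
  proof -
    have "E ** Q = Q ** diag_matrix d"
      using Q by (simp add: matrix_mul_assoc[symmetric])
    hence "E *v column i Q = d i *\<^sub>R column i Q"
      unfolding column_matrix_mult[symmetric]
      by (simp add: vec_eq_iff column_def matrix_matrix_mult_def diag_matrix_def
          if_distrib[of "(*) _"] cong: if_cong)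
    moreover have "column i Q \<noteq> 0"
    proof
      assume "column i Q = 0"
      hence "column i (transpose Q ** Q) = 0" by (simp add: column_matrix_mult)
      hence "column i (mat 1 :: real^'n^'n) $ i = 0" using Q(1) by simp
      thus False by (simp add: column_def mat_def)
    qed
    ultimately show ?thesis
      using \<open>\<And>v m. \<lbrakk>E *v v = m *\<^sub>R v; v \<noteq> 0\<rbrakk> \<Longrightarrow> m = 0\<close> by blast
  qed
  have "diag_matrix d = 0" by (simp add: d0 diag_matrix_def vec_eq_iff)
  thus ?thesis using Q(2) by (simp add: E_def)
qed

lemma diag_matrix_vector_mult:
  fixes d :: "'n::finite \<Rightarrow> real"
  shows "diag_matrix d *v y = (\<chi> i. d i * y $ i)"
  by (simp add: vec_eq_iff matrix_vector_mult_def diag_matrix_def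
      if_distrib[of "\<lambda>x. x * _"] cong: if_cong)

text \<open>Take roots of the eigenvalues in an orthogonal diagonalization.\<close>

lemma sym_pos_def_sqrt_exists:
  fixes B :: "real^'n^'n"
  assumes B: "sym_pos_def B"
  shows "\<exists>S. sym_pos_def S \<and> S ** S = B"
proof -
  obtain Q :: "real^'n^'n" and d where Q: "transpose Q ** Q = mat 1" "Q ** transpose Q = mat 1"
      "B = Q ** diag_matrix d ** transpose Q"
    using symmetric_matrix_diagonalization[of B] B unfolding sym_pos_def_def by blast
  have form: "x \<bullet> ((Q ** diag_matrix e ** transpose Q) *v x) = (\<Sum>i\<in>UNIV. e i * (x v* Q) $ i ^ 2)" for x e
    using quadratic_form_mult[of x "transpose Q" "diag_matrix e"]
    by (simp add: diag_matrix_vector_mult inner_vec_def power2_eq_square mult_ac)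
  have d: "d i > 0" for i
  proof -
    \<comment> \<open>The vector \<open>axis i 1 v* transpose Q\<close> is the \<open>i\<close>-th
      column of \<open>Q\<close>, an eigenvector on which the quadratic form of \<open>B\<close>
      takes the value \<open>d i\<close>.\<close>
    have "axis i 1 v* transpose Q v* Q = axis i 1"
      using Q(1) by (simp only: vector_matrix_mul_assoc vector_matrix_mul_rid)
    moreover from this have "axis i 1 v* transpose Q \<noteq> 0" by (auto simp del: vector_transpose_matrix)
    ultimately have "0 < (\<Sum>j\<in>UNIV. d j * (axis i 1 $ j) ^ 2)"
      using B form[of "axis i 1 v* transpose Q" d] Q(3) unfolding sym_pos_def_def by metis
    thus ?thesis
      by (simp add: axis_def if_distrib[of "\<lambda>x. x ^ 2"] if_distrib[of "(*) _"] cong: if_cong)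
  qed
  define S where "S = Q ** diag_matrix (\<lambda>i. sqrt (d i)) ** transpose Q"
  have "S ** S = Q ** diag_matrix (\<lambda>i. sqrt (d i)) ** (transpose Q ** Q) ** diag_matrix (\<lambda>i. sqrt (d i)) ** transpose Q"
    by (simp only: S_def matrix_mul_assoc)
  also have "\<dots> = Q ** (diag_matrix (\<lambda>i. sqrt (d i)) ** diag_matrix (\<lambda>i. sqrt (d i))) ** transpose Q"
    by (simp add: Q(1) matrix_mul_assoc)
  also have "\<dots> = B"
    using d by (simp add: diag_matrix_mult Q(3) less_imp_le)
  finally have "S ** S = B" .
  moreover have "sym_pos_def S"
    unfolding sym_pos_def_def
  proof (intro conjI allI impI)
    show "transpose S = S"
      by (simp add: S_def matrix_transpose_mul matrix_mul_assoc)
    fix x :: "real^'n" assume "x \<noteq> 0"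
    have "x v* Q \<noteq> 0"
    proof
      assume "x v* Q = 0"
      hence "x v* Q v* transpose Q = 0" by simp
      hence "x v* (Q ** transpose Q) = 0" by (simp only: vector_matrix_mul_assoc)
      thus False using Q(2) \<open>x \<noteq> 0\<close> by simp
    qed
    then obtain i where "(x v* Q) $ i \<noteq> 0" by (auto simp: vec_eq_iff)
    thus "x \<bullet> (S *v x) > 0"
      unfolding S_def form using d
      by (intro sum_pos2[of _ i]) (auto intro!: mult_nonneg_nonneg simp: less_imp_le)
  qed
  ultimately show ?thesis by blast
qed

lemma spd_sqrt:
  assumes "sym_pos_def B"
  shows "sym_pos_def (spd_sqrt B)" "spd_sqrt B ** spd_sqrt B = B"
proof -
  have "\<exists>!S. sym_pos_def S \<and> S ** S = B"
    using sym_pos_def_sqrt_exists[OF assms] sym_pos_def_sqrt_unique by blast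
  from theI'[OF this] show "sym_pos_def (spd_sqrt B)" "spd_sqrt B ** spd_sqrt B = B"
    by (auto simp: spd_sqrt_def)
qed

lemma matrix_add_rdistrib: "(A + B) ** (C :: 'a::semiring_1^'n^'m) = A ** C + B ** C"
  by (simp add: vec_eq_iff matrix_matrix_mult_def sum.distrib algebra_simps)

lemma sum_list_sorted_list_of_multiset:
  fixes h :: "'a::linorder \<Rightarrow> real" and g :: "'i::finite \<Rightarrow> 'a"
  shows "(\<Sum>x\<leftarrow>sorted_list_of_multiset (image_mset g (mset_set UNIV)). h x) = (\<Sum>i\<in>UNIV. h (g i))"
proof -
  have "(\<Sum>x\<leftarrow>sorted_list_of_multiset M. h x) = (\<Sum>x\<in>#M. h x)" for M
    by (metis mset_map mset_sorted_list_of_multiset sum_mset_sum_list)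
  thus ?thesis by (simp add: sum_unfold_sum_mset image_mset.compositionality o_def)
qed

section \<open>The objective near an invariant subspace with a spectral gap\<close>

text \<open>Only quadratic form bounds are assumed here, so the convergence argument never handles
  eigenvalues of \<open>A\<close> directly. In the application \<open>a\<close>, \<open>b\<close>,
  \<open>l\<close>, \<open>m\<close> are \<open>lam 1\<close>, \<open>lam n\<close>,
  \<open>lam p\<close>, \<open>lam (p + 1)\<close>, so that \<open>a - b\<close> is \<open>L\<close>
  and \<open>l - m\<close> is \<open>\<delta>\<close>.\<close>

locale spectral_gap =
  fixes A :: "real^'n^'n" and V :: "real^'p^'n" and a b l m :: real
  assumes sym: "transpose A = A"
    and upper: "x \<bullet> (A *v x) \<le> a * (x \<bullet> x)"
    and lower: "b * (x \<bullet> x) \<le> x \<bullet> (A *v x)"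
    and V: "orthonormal_columns V"
    and inv: "A ** V = V ** (transpose V ** A ** V)"
    and top: "l * (y \<bullet> y) \<le> (V *v y) \<bullet> (A *v (V *v y))"
    and bot: "transpose V *v x = 0 \<Longrightarrow> x \<bullet> (A *v x) \<le> m * (x \<bullet> x)"
    and gap: "m < l" and bm: "b \<le> m" and la: "l \<le> a"
begin

text \<open>\<open>resid X\<close> is the part of \<open>X\<close> orthogonal to the span of
  \<open>V\<close>. Its squared norm \<open>defect\<close> is the sum of the squared sines of the
  principal angles, a substitute for the squared distance that is polynomial in
  \<open>X\<close>.\<close>

definition "resid X = X - V ** (transpose V ** X)"
definition "defect X = resid X \<bullet> resid X"
definition "excess X = \<phi> A X - \<phi> A V"

abbreviation "\<Lambda> \<equiv> transpose V ** A ** V"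

lemma VV: "transpose V ** V = mat 1"
  using V by (simp add: orthonormal_columns_def)

lemma sym_form: "transpose (transpose X ** A ** X) = transpose X ** A ** X"
  by (simp add: matrix_transpose_mul sym matrix_mul_assoc)

lemma form_upper:
  assumes "orthonormal_columns X"
  shows "y \<bullet> ((transpose X ** A ** X) *v y) \<le> a * (y \<bullet> y)"
  using upper[of "X *v y"] orthonormal_columns_inner[OF assms]
  by (simp add: quadratic_form_mult)

text \<open>Stated for any orthonormal \<open>X\<close> because it is applied to \<open>V\<close>
  when bounding the excess and to the current iterate when bounding the decrease.\<close>

lemma form_rows_upper:
  fixes Z :: "real^'q^'r" and X :: "real^'q^'n"
  assumes "orthonormal_columns X"
  shows "(Z ** (transpose X ** A ** X)) \<bullet> Z \<le> a * (Z \<bullet> Z)"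
  using quadratic_form_columns_le[of "transpose Z" "transpose X ** A ** X" a] form_upper[OF assms]
  by (simp add: quadratic_form_rows[OF sym_form] inner_transpose)

lemma form_rows_lower:
  fixes Z :: "real^'p^'r"
  shows "l * (Z \<bullet> Z) \<le> (Z ** \<Lambda>) \<bullet> Z"
  using quadratic_form_columns_ge[of l "transpose Z" \<Lambda>] top
  by (simp add: quadratic_form_rows[OF sym_form] inner_transpose quadratic_form_mult)

lemma transpose_V_resid: "transpose V ** resid X = 0"
  by (simp add: resid_def matrix_diff_ldistrib matrix_mul_assoc VV)

lemma resid_upper: "resid X \<bullet> (A ** resid X) \<le> m * defect X"
  unfolding defect_def
proof (rule quadratic_form_columns_le)
  fix j
  have "transpose V *v column j (resid X) = 0"
    unfolding column_matrix_mult[symmetric] transpose_V_resid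
    by (simp add: column_def vec_eq_iff)
  thus "column j (resid X) \<bullet> (A *v column j (resid X))
      \<le> m * (column j (resid X) \<bullet> column j (resid X))" by (rule bot)
qed

lemma resid_lower: "b * defect X \<le> resid X \<bullet> (A ** resid X)"
  unfolding defect_def by (rule quadratic_form_columns_ge) (rule lower)

text \<open>Pythagoras for the components of \<open>X *v u\<close> in the span of \<open>V\<close>
  and orthogonal to it, \<open>X\<close> being an isometry.\<close>

lemma norm_split:
  assumes X: "orthonormal_columns X"
  shows "u \<bullet> u = (resid X *v u) \<bullet> (resid X *v u)
    + (transpose V ** X *v u) \<bullet> (transpose V ** X *v u)"
proof -
  have "X *v u = resid X *v u + V *v (transpose V ** X *v u)"
    unfolding matrix_vector_mul_assoc
    by (simp add: resid_def matrix_vector_mult_add_rdistrib[symmetric])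
  moreover have "(resid X *v u) \<bullet> (V *v (transpose V ** X *v u)) = 0"
  proof -
    have "(V *v (transpose V ** X *v u)) \<bullet> (resid X *v u) = (transpose V ** X *v u) \<bullet> (transpose V *v (resid X *v u))"
      by (rule inner_transpose_matrix_vector)
    also have "\<dots> = 0"
      by (simp only: matrix_vector_mul_assoc transpose_V_resid matrix_vector_mult_0 inner_zero_right)
    finally show ?thesis by (simp add: inner_commute)
  qed
  ultimately show ?thesis
    using orthonormal_columns_inner[OF X, of u u] orthonormal_columns_inner[OF V, of "transpose V ** X *v u" "transpose V ** X *v u"]
    by (simp add: inner_add_left inner_add_right inner_commute)
qed

text \<open>Everything is expanded in \<open>C = transpose V ** X\<close>. The defect depends only
  on the norm of \<open>C\<close>, which does not change when \<open>X\<close> and \<open>V\<close>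
  are exchanged. In the last identity both forms on the right contain the term
  \<open>C \<bullet> (\<Lambda> ** C)\<close>, which cancels. The first form lies between
  \<open>l\<close> and \<open>a\<close> times the defect and the second between \<open>b\<close> and
  \<open>m\<close> times it, which yields both bounds on the excess.\<close>

lemma
  fixes X :: "real^'p^'n"
  assumes X: "orthonormal_columns X"
  shows defect_sym: "defect X = (V - X ** (transpose X ** V)) \<bullet> (V - X ** (transpose X ** V))"
    and defect_eq: "defect X = CARD('p) - (transpose V ** X) \<bullet> (transpose V ** X)"
    and excess_eq: "2 * excess X = ((V - X ** (transpose X ** V)) ** \<Lambda>) \<bullet> (V - X ** (transpose X ** V))
      - resid X \<bullet> (A ** resid X)"
proof -
  define C where "C = transpose V ** X"
  have CT: "transpose X ** V = transpose C"
    by (simp add: C_def matrix_transpose_mul)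
  have XX: "transpose X ** X = mat 1"
    using X by (simp add: orthonormal_columns_def)
  have XVC: "X \<bullet> (V ** Z) = C \<bullet> Z" for Z
    by (simp add: C_def inner_matrix_mult_left)
  have VCX: "(V ** Z) \<bullet> X = C \<bullet> Z" for Z
    using XVC by (simp add: inner_commute)
  have VXC: "V \<bullet> (X ** Z) = transpose C \<bullet> Z" for Z
    by (simp add: CT[symmetric] inner_matrix_mult_left)
  have XCV: "(X ** Z) \<bullet> V = transpose C \<bullet> Z" for Z
    using VXC by (simp add: inner_commute)
  show s1: "defect X = CARD('p) - (transpose V ** X) \<bullet> (transpose V ** X)"
    unfolding C_def[symmetric]
    by (simp add: defect_def resid_def inner_diff_left inner_diff_right C_def[symmetric] XVC VCX
        orthonormal_columns_mult_inner[OF V] orthonormal_columns_inner_self[OF X])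
  show "defect X = (V - X ** (transpose X ** V)) \<bullet> (V - X ** (transpose X ** V))"
    using s1 unfolding C_def[symmetric] CT
    by (simp add: inner_diff_left inner_diff_right VXC XCV inner_transpose
        orthonormal_columns_mult_inner[OF X] orthonormal_columns_inner_self[OF V])
  have "((V - X ** transpose C) ** \<Lambda>) \<bullet> (V - X ** transpose C)
    = (V ** \<Lambda>) \<bullet> V - (V ** \<Lambda>) \<bullet> (X ** transpose C) - (X ** (transpose C ** \<Lambda>)) \<bullet> V
      + (X ** (transpose C ** \<Lambda>)) \<bullet> (X ** transpose C)"
    by (simp add: matrix_diff_rdistrib inner_diff_left inner_diff_right matrix_mul_assoc)
  also have "(V ** \<Lambda>) \<bullet> V = V \<bullet> (A ** V)"
    by (simp add: inv[symmetric] inner_commute)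
  also have "(X ** (transpose C ** \<Lambda>)) \<bullet> V = (transpose C ** \<Lambda>) \<bullet> transpose C"
    unfolding XCV by (rule inner_commute)
  also have "(V ** \<Lambda>) \<bullet> (X ** transpose C) = V \<bullet> (X ** (transpose C ** \<Lambda>))"
    by (subst inner_matrix_mult_right) (simp only: sym_form matrix_mul_assoc)
  also have "\<dots> = (transpose C ** \<Lambda>) \<bullet> transpose C"
    unfolding VXC by (rule inner_commute)
  also have "(X ** (transpose C ** \<Lambda>)) \<bullet> (X ** transpose C) = (transpose C ** \<Lambda>) \<bullet> transpose C"
    by (rule orthonormal_columns_mult_inner[OF X])
  also have "(transpose C ** \<Lambda>) \<bullet> transpose C = C \<bullet> (\<Lambda> ** C)"
    using quadratic_form_rows[OF sym_form, of "transpose C" V] by simp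
  finally have Y: "((V - X ** transpose C) ** \<Lambda>) \<bullet> (V - X ** transpose C)
    = V \<bullet> (A ** V) - C \<bullet> (\<Lambda> ** C)" by simp
  \<comment> \<open>Invariance of the span of \<open>V\<close> reduces the cross terms to the form
    of \<open>\<Lambda>\<close> at \<open>C\<close>.\<close>
  have AVC: "A ** (V ** C) = V ** (\<Lambda> ** C)"
    using inv by (simp add: matrix_mul_assoc)
  have "resid X \<bullet> (A ** resid X)
    = X \<bullet> (A ** X) - X \<bullet> (A ** (V ** C)) - (V ** C) \<bullet> (A ** X) + (V ** C) \<bullet> (A ** (V ** C))"
    by (simp add: resid_def C_def[symmetric] matrix_diff_ldistrib inner_diff_left inner_diff_right)
  also have "(V ** C) \<bullet> (A ** X) = X \<bullet> (A ** (V ** C))"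
    by (subst inner_commute) (simp add: inner_matrix_mult_left sym)
  also have "X \<bullet> (A ** (V ** C)) = C \<bullet> (\<Lambda> ** C)"
    by (simp add: AVC XVC)
  also have "(V ** C) \<bullet> (A ** (V ** C)) = C \<bullet> (\<Lambda> ** C)"
    by (simp add: AVC orthonormal_columns_mult_inner[OF V])
  finally have "resid X \<bullet> (A ** resid X) = X \<bullet> (A ** X) - C \<bullet> (\<Lambda> ** C)" by simp
  thus "2 * excess X = ((V - X ** (transpose X ** V)) ** \<Lambda>) \<bullet> (V - X ** (transpose X ** V))
      - resid X \<bullet> (A ** resid X)"
    unfolding CT by (simp add: Y excess_def \<phi>_eq_inner field_simps)
qed

lemma excess_lower:
  fixes X :: "real^'p^'n"
  assumes X: "orthonormal_columns X"
  shows "(l - m) * defect X \<le> 2 * excess X"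
  using form_rows_lower[of "V - X ** (transpose X ** V)"] resid_upper[of X]
  unfolding excess_eq[OF X] defect_sym[OF X, symmetric] left_diff_distrib by linarith

lemma excess_upper:
  fixes X :: "real^'p^'n"
  assumes X: "orthonormal_columns X"
  shows "2 * excess X \<le> (a - b) * defect X"
  using form_rows_upper[OF V, of "V - X ** (transpose X ** V)"] resid_lower[of X]
  unfolding excess_eq[OF X] defect_sym[OF X, symmetric] left_diff_distrib by linarith

lemma defect_nonneg: "defect X \<ge> 0" by (simp add: defect_def)

lemma excess_nonneg:
  fixes X :: "real^'p^'n"
  assumes X: "orthonormal_columns X"
  shows "excess X \<ge> 0"
  using excess_lower[OF X] mult_nonneg_nonneg[of "l - m" "defect X"] defect_nonneg[of X] gap by linarith

section \<open>Lower bound on the gradient by the excess\<close>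

text \<open>An inequality of Polyak-Lojasiewicz type. With \<open>s = defect X\<close> and
  \<open>f = excess X\<close>, Cauchy-Schwarz against the tangent vector \<open>W\<close> gives
  \<open>(1 - s) (2 f)^2 \<le> s (G \<bullet> G)\<close>; the bound
  \<open>(l - m) s \<le> 2 f\<close> then cancels one factor \<open>2 f\<close>.\<close>

lemma gradient_domination:
  fixes X :: "real^'p^'n"
  assumes X: "orthonormal_columns X" and s1: "defect X < 1"
  shows "2 * (l - m) * (1 - defect X) * excess X \<le> grad_\<phi> A X \<bullet> grad_\<phi> A X"
proof -
  define C where "C = transpose V ** X"
  define B where "B = transpose X ** A ** X"
  define G where "G = grad_\<phi> A X"
  define Y where "Y = V - X ** (transpose X ** V)"
  have CT: "transpose X ** V = transpose C"
    by (simp add: C_def matrix_transpose_mul)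
  \<comment> \<open>The spectral norm of \<open>resid X\<close> is at most its Frobenius norm, so
    the squared singular values of \<open>C\<close> are at least \<open>1 - defect X\<close>. Hence
    \<open>C\<close> is invertible and its inverse is bounded.\<close>
  have C_lower: "(1 - defect X) * (u \<bullet> u) \<le> (C *v u) \<bullet> (C *v u)" for u
  proof -
    have "u \<bullet> u = (resid X *v u) \<bullet> (resid X *v u) + (C *v u) \<bullet> (C *v u)"
      unfolding C_def by (rule norm_split[OF X])
    thus ?thesis
      using norm_matrix_vector_le_frobenius[of "resid X" u] by (simp add: defect_def algebra_simps)
  qed
  have "\<forall>x. C *v x = 0 \<longrightarrow> x = 0"
  proof (intro allI impI)
    fix x assume "C *v x = 0"
    with C_lower[of x] have "(1 - defect X) * (x \<bullet> x) \<le> 0" by simp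
    with s1 have "x \<bullet> x \<le> 0" by (simp add: mult_le_0_iff)
    thus "x = 0" by (metis inner_gt_zero_iff not_less)
  qed
  then obtain J where JC: "J ** C = mat 1"
    using matrix_left_invertible_ker by blast
  hence CJ: "C ** J = mat 1" by (simp add: matrix_left_right_inverse)
  define K where "K = transpose J"
  have CTK: "transpose C ** K = mat 1"
    using JC by (simp add: K_def matrix_transpose_mul[symmetric])
  \<comment> \<open>\<open>K\<close> is the inverse of \<open>transpose C\<close>, so
    \<open>V ** K\<close> has the same span as \<open>V\<close> while
    \<open>transpose X ** W = 0\<close>: \<open>W\<close> is a tangent vector at \<open>X\<close>
    pointing to the minimizing subspace.\<close>
  define W where "W = V ** K - X"
  have "G \<bullet> W = - (2 * excess X)"
  proof -
    have "G \<bullet> X = 0"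
    proof -
      have "X \<bullet> G = (X ** mat 1) \<bullet> G" by simp
      also have "\<dots> = 0"
        unfolding inner_matrix_mult_left using orthogonal_grad_\<phi>[OF X] by (simp add: G_def)
      finally show ?thesis by (simp add: inner_commute)
    qed
    hence "G \<bullet> W = G \<bullet> (V ** K)" by (simp add: W_def inner_diff_right)
    also have "\<dots> = (X ** B) \<bullet> (V ** K) - (A ** X) \<bullet> (V ** K)"
      by (simp add: G_def B_def grad_\<phi>_eq inner_diff_left)
    also have "(X ** B) \<bullet> (V ** K) = B \<bullet> mat 1"
      by (simp add: inner_matrix_mult_left[of X] matrix_mul_assoc CT CTK)
    also have "B \<bullet> mat 1 = X \<bullet> (A ** X)"
    proof -
      have "X \<bullet> (A ** X) = (X ** mat 1) \<bullet> (A ** X)" by simp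
      also have "\<dots> = mat 1 \<bullet> B"
        unfolding inner_matrix_mult_left by (simp add: B_def matrix_mul_assoc)
      finally show ?thesis by (simp add: inner_commute)
    qed
    also have "(A ** X) \<bullet> (V ** K) = X \<bullet> (A ** V ** K)"
      by (simp add: inner_matrix_mult_left sym matrix_mul_assoc)
    also have "\<dots> = (V ** (\<Lambda> ** K)) \<bullet> X"
      using inv by (simp add: inner_commute matrix_mul_assoc)
    also have "\<dots> = (\<Lambda> ** K) \<bullet> C"
      by (simp add: inner_matrix_mult_left[of V] C_def)
    also have "\<dots> = \<Lambda> \<bullet> (C ** J)"
      by (simp add: inner_matrix_mult_right[of \<Lambda>] K_def)
    also have "\<dots> = V \<bullet> (A ** V)"
    proof -
      have "V \<bullet> (A ** V) = (V ** mat 1) \<bullet> (A ** V)" by simp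
      also have "\<dots> = mat 1 \<bullet> \<Lambda>"
        unfolding inner_matrix_mult_left by (simp add: matrix_mul_assoc)
      finally show ?thesis by (simp add: CJ inner_commute)
    qed
    finally show ?thesis by (simp add: excess_def \<phi>_eq_inner)
  qed
  hence "(2 * excess X)\<^sup>2 \<le> (G \<bullet> G) * (W \<bullet> W)"
    using Cauchy_Schwarz_ineq[of G W] by simp
  moreover have "(1 - defect X) * (W \<bullet> W) \<le> defect X"
  proof -
    \<comment> \<open>Factoring out \<open>K\<close> leaves \<open>Y\<close>, whose squared norm is
      the defect by the symmetry in \<open>X\<close> and \<open>V\<close>; \<open>K\<close> costs at
      most the factor \<open>1 / (1 - defect X)\<close>.\<close>
    have W: "W = Y ** K"
    proof -
      have "X ** (transpose X ** V) ** K = X ** (transpose X ** V ** K)"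
        by (simp only: matrix_mul_assoc)
      thus ?thesis by (simp add: W_def Y_def matrix_diff_rdistrib CT CTK)
    qed
    have J: "(1 - defect X) * (v \<bullet> (transpose J ** J *v v)) \<le> v \<bullet> v" for v
    proof -
      have "C *v (J *v v) = v" by (simp add: matrix_vector_mul_assoc CJ)
      thus ?thesis
        using C_lower[of "J *v v"] quadratic_form_mult[of v J "mat 1"] by simp
    qed
    have "W \<bullet> W = transpose Y \<bullet> (transpose J ** J ** transpose Y)"
      unfolding W using inner_transpose[of "Y ** K" "Y ** K"]
      by (simp add: matrix_transpose_mul K_def inner_matrix_mult_left[of J] matrix_mul_assoc)
    also have "\<dots> \<le> (1 / (1 - defect X)) * (transpose Y \<bullet> transpose Y)"
      using J s1 by (intro quadratic_form_columns_le) (simp add: field_simps)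
    also have "transpose Y \<bullet> transpose Y = defect X"
      by (simp add: inner_transpose defect_sym[OF X] Y_def)
    finally show ?thesis using s1 by (simp add: field_simps)
  qed
  ultimately have "(1 - defect X) * (2 * excess X)\<^sup>2 \<le> (1 - defect X) * ((G \<bullet> G) * (W \<bullet> W))"
      and "(G \<bullet> G) * ((1 - defect X) * (W \<bullet> W)) \<le> (G \<bullet> G) * defect X"
    using s1 by (intro mult_left_mono; simp)+
  hence *: "(1 - defect X) * (2 * excess X)\<^sup>2 \<le> (G \<bullet> G) * defect X"
    by (simp add: mult.left_commute)
  \<comment> \<open>The case split is for the cancellation of \<open>2 * excess X\<close>.\<close>
  show ?thesis
  proof (cases "excess X = 0")
    case False
    hence D: "excess X > 0" using excess_nonneg[OF X] by simp
    have "(l - m) * ((1 - defect X) * (2 * excess X)\<^sup>2) \<le> (l - m) * ((G \<bullet> G) * defect X)"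
      using * gap by (intro mult_left_mono) auto
    also have "\<dots> = (G \<bullet> G) * ((l - m) * defect X)" by simp
    also have "\<dots> \<le> (G \<bullet> G) * (2 * excess X)"
      by (intro mult_left_mono excess_lower X) auto
    finally have "(2 * (l - m) * (1 - defect X) * excess X) * (2 * excess X) \<le> (G \<bullet> G) * (2 * excess X)"
      by (simp only: power2_eq_square mult.assoc mult.left_commute mult.commute)
    thus ?thesis using D by (simp add: G_def)
  qed simp
qed

section \<open>Decrease along the search curve\<close>

text \<open>The gradient is an off-diagonal block of \<open>A\<close>, up to sign:
  \<open>u = X *v v\<close> and \<open>w = G *v v\<close> are orthogonal and
  \<open>w \<bullet> (A *v u) = - (w \<bullet> w)\<close>. The upper form bound at
  \<open>u - t w\<close> and the lower one at \<open>u + t w\<close> isolate this block when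
  subtracted.\<close>

lemma gradient_bound:
  assumes X: "orthonormal_columns X"
  shows "4 * ((grad_\<phi> A X *v v) \<bullet> (grad_\<phi> A X *v v)) \<le> (a - b)\<^sup>2 * (v \<bullet> v)"
proof -
  define w where "w = grad_\<phi> A X *v v"
  define u where "u = X *v v"
  have L: "a - b > 0" using gap bm la by linarith
  have uu: "u \<bullet> u = v \<bullet> v" by (simp add: u_def orthonormal_columns_inner[OF X])
  have wu: "w \<bullet> (X *v z) = 0" for z
  proof -
    have "(X *v z) \<bullet> w = z \<bullet> (transpose X *v (grad_\<phi> A X *v v))"
      unfolding w_def by (rule inner_transpose_matrix_vector)
    also have "\<dots> = 0"
      by (simp only: matrix_vector_mul_assoc orthogonal_grad_\<phi>[OF X] matrix_vector_mult_0 inner_zero_right)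
    finally show ?thesis by (simp add: inner_commute)
  qed
  have "w = X *v (transpose X ** A ** X *v v) - A *v u"
    unfolding w_def u_def grad_\<phi>_eq
    by (simp only: matrix_vector_mult_diff_rdistrib matrix_vector_mul_assoc)
  hence wAu: "w \<bullet> (A *v u) = - (w \<bullet> w)"
    using wu by (simp add: inner_diff_right)
  have Auw: "u \<bullet> (A *v w) = - (w \<bullet> w)"
    using wAu inner_transpose_matrix_vector[of A u w] sym by (simp add: inner_commute)
  \<comment> \<open>This value maximizes \<open>4 t - (a - b) t^2\<close> and so gives the sharpest
    estimate.\<close>
  define t where "t = 2 / (a - b)"
  have wu0: "w \<bullet> u = 0" using wu by (simp add: u_def)
  have "(u - t *\<^sub>R w) \<bullet> (A *v (u - t *\<^sub>R w)) \<le> a * ((u - t *\<^sub>R w) \<bullet> (u - t *\<^sub>R w))" by (rule upper)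
  moreover have "b * ((u + t *\<^sub>R w) \<bullet> (u + t *\<^sub>R w)) \<le> (u + t *\<^sub>R w) \<bullet> (A *v (u + t *\<^sub>R w))" by (rule lower)
  ultimately have "4 * t * (w \<bullet> w) \<le> (a - b) * (u \<bullet> u + t\<^sup>2 * (w \<bullet> w))"
    using wu0 wAu Auw
    by (simp add: matrix_vector_mult_diff_distrib matrix_vector_right_distrib matrix_vector_mult_scaleR
        inner_add_left inner_add_right inner_diff_left inner_diff_right inner_commute[of u w]
        algebra_simps power2_eq_square)
  hence "(a - b) * (4 * t * (w \<bullet> w)) \<le> (a - b) * ((a - b) * (u \<bullet> u + t\<^sup>2 * (w \<bullet> w)))"
    using L by (intro mult_left_mono) auto
  also have "(a - b) * (4 * t * (w \<bullet> w)) = 4 * ((a - b) * t) * (w \<bullet> w)" by simp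
  also have "(a - b) * ((a - b) * (u \<bullet> u + t\<^sup>2 * (w \<bullet> w)))
      = (a - b)\<^sup>2 * (u \<bullet> u) + ((a - b) * t)\<^sup>2 * (w \<bullet> w)"
    by (simp add: algebra_simps power2_eq_square)
  also have "(a - b) * t = 2"
    using L by (simp add: t_def del: left_diff_distrib_numeral right_diff_distrib_numeral)
  finally show ?thesis by (simp add: uu w_def)
qed

text \<open>With \<open>Z = G ** T\<close> the change of \<open>X \<bullet> (A ** X)\<close> is an
  exact expression in \<open>Z\<close>, at least \<open>\<mu> (Z \<bullet> Z)\<close> for
  \<open>\<mu> = 1 / (a - b)\<close>. The normalization by \<open>T\<close> shrinks the squared norm
  of the gradient by at most the factor 4/5, and the factor 1/2 in the objective turns this into
  2/5.\<close>

lemma line_point_decrease: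
  fixes X :: "real^'p^'n"
  assumes X: "orthonormal_columns X"
  shows "orthonormal_columns (line_point A X \<mu>)"
    and "\<mu> = 1 / (a - b) \<Longrightarrow>
      \<phi> A (line_point A X \<mu>) \<le> \<phi> A X - 2 / (5 * (a - b)) * (grad_\<phi> A X \<bullet> grad_\<phi> A X)"
proof -
  define G where "G = grad_\<phi> A X"
  define M where "M = mat 1 + \<mu>\<^sup>2 *\<^sub>R (transpose G ** G)"
  define S where "S = spd_sqrt M"
  define T where "T = matrix_inv S"
  define W where "W = X - \<mu> *\<^sub>R G"
  define B where "B = transpose X ** A ** X"
  define Z where "Z = G ** T"
  have L: "a - b > 0" using gap bm la by linarith
  have XX: "transpose X ** X = mat 1" using X by (simp add: orthonormal_columns_def)
  have XG: "transpose X ** G = 0" using orthogonal_grad_\<phi>[OF X] by (simp add: G_def)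
  have GX: "transpose G ** X = 0"
    using arg_cong[OF XG, of transpose] by (simp add: matrix_transpose_mul transpose_def[of 0] vec_eq_iff)
  have lp: "line_point A X \<mu> = W ** T"
    by (simp add: line_point_def Let_def G_def M_def S_def T_def W_def)
  have symM: "sym_pos_def M"
    unfolding sym_pos_def_def
  proof (intro conjI allI impI)
    show "transpose M = M"
      by (simp add: M_def transpose_add transpose_scalar matrix_transpose_mul)
    fix x :: "real^'p" assume "x \<noteq> 0"
    have "x \<bullet> (M *v x) = x \<bullet> x + \<mu>\<^sup>2 * (x \<bullet> (transpose G ** G *v x))"
      by (simp only: M_def matrix_vector_mult_add_rdistrib matrix_vector_mul_lid inner_add_right
          scaleR_matrix_vector_assoc[symmetric] inner_scaleR_right)
    also have "x \<bullet> (transpose G ** G *v x) = (G *v x) \<bullet> (G *v x)"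
      using quadratic_form_mult[of x G "mat 1"] by simp
    finally have eq: "x \<bullet> (M *v x) = x \<bullet> x + \<mu>\<^sup>2 * ((G *v x) \<bullet> (G *v x))" .
    have "x \<bullet> x > 0" using \<open>x \<noteq> 0\<close> by simp
    moreover have "\<mu>\<^sup>2 * ((G *v x) \<bullet> (G *v x)) \<ge> 0" by simp
    ultimately show "x \<bullet> (M *v x) > 0" unfolding eq by linarith
  qed
  have S: "sym_pos_def S" "S ** S = M" using spd_sqrt[OF symM] by (simp_all add: S_def)
  \<comment> \<open>\<open>matrix_inv\<close> is a choice operator, so invertibility of
    \<open>S\<close> is what provides both inverse laws.\<close>
  have "S ** T = mat 1 \<and> T ** S = mat 1"
    using sym_pos_def_invertible[OF S(1)] unfolding invertible_def T_def matrix_inv_def by (rule someI_ex)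
  hence ST: "S ** T = mat 1" and TS: "T ** S = mat 1" by auto
  have Ssym: "transpose S = S" using S(1) by (simp add: sym_pos_def_def)
  have Tsym: "transpose T = T"
  proof -
    have "transpose T ** S = mat 1"
      using arg_cong[OF ST, of transpose] by (simp add: matrix_transpose_mul Ssym)
    hence "transpose T ** (S ** T) = T" by (simp add: matrix_mul_assoc)
    thus ?thesis by (simp add: ST)
  qed
  have TMT: "T ** M ** T = mat 1"
  proof -
    have "T ** M ** T = (T ** S) ** (S ** T)" by (simp add: S(2)[symmetric] matrix_mul_assoc)
    thus ?thesis by (simp add: ST TS)
  qed
  have WW: "transpose W ** W = M"
    by (simp add: W_def M_def transpose_diff transpose_scalar matrix_diff_ldistrib matrix_diff_rdistrib
        matrix_scalar_ac scalar_matrix_assoc[symmetric] XX XG GX power2_eq_square)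
  show "orthonormal_columns (line_point A X \<mu>)"
    unfolding orthonormal_columns_def lp using TMT
    by (simp add: matrix_transpose_mul Tsym WW[symmetric] matrix_mul_assoc)
  \<comment> \<open>Splitting the identity this way expresses the old value
    \<open>X \<bullet> (A ** X)\<close> through \<open>T ** T\<close> and \<open>Z\<close>, so that
    the terms in \<open>T ** T\<close> cancel against the new value.\<close>
  have TT: "T ** T + \<mu>\<^sup>2 *\<^sub>R (transpose Z ** Z) = mat 1"
    using TMT by (simp add: M_def Z_def matrix_add_ldistrib matrix_add_rdistrib matrix_scalar_ac
        scalar_matrix_assoc[symmetric] matrix_transpose_mul Tsym matrix_mul_assoc)
  have XZ: "transpose X ** Z = 0" by (simp add: Z_def matrix_mul_assoc XG)
  \<comment> \<open>This is \<open>A ** X = X ** B - G\<close> times \<open>T\<close>. As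
    \<open>Z\<close> is orthogonal to the columns of \<open>X\<close>, both cross terms equal
    \<open>- (Z \<bullet> Z)\<close>.\<close>
  have AX: "A ** (X ** T) = X ** (B ** T) - Z"
    by (simp add: Z_def G_def grad_\<phi>_eq B_def matrix_diff_rdistrib matrix_mul_assoc)
  have ZAX: "Z \<bullet> (A ** (X ** T)) = - (Z \<bullet> Z)"
    by (simp add: AX inner_diff_right inner_commute[of Z "X ** _"] inner_matrix_mult_left XZ)
  have XAZ: "(X ** T) \<bullet> (A ** Z) = - (Z \<bullet> Z)"
    by (subst inner_commute) (simp add: inner_matrix_mult_left sym ZAX)
  have XAX: "(X ** T) \<bullet> (A ** (X ** T)) = B \<bullet> (T ** T)"
  proof -
    have "(X ** T) \<bullet> (A ** (X ** T)) = T \<bullet> (B ** T)"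
      by (simp add: inner_matrix_mult_left[of X] B_def matrix_mul_assoc)
    also have "\<dots> = B \<bullet> (T ** T)"
      by (subst inner_commute) (simp add: inner_matrix_mult_right[of B] Tsym)
    finally show ?thesis .
  qed
  have BI: "X \<bullet> (A ** X) = B \<bullet> (T ** T) + \<mu>\<^sup>2 * ((Z ** B) \<bullet> Z)"
  proof -
    have "X \<bullet> (A ** X) = (X ** mat 1) \<bullet> (A ** X)" by simp
    also have "\<dots> = B \<bullet> mat 1"
      unfolding inner_matrix_mult_left by (simp add: B_def matrix_mul_assoc inner_commute)
    also have "\<dots> = B \<bullet> (T ** T) + \<mu>\<^sup>2 * (B \<bullet> (transpose Z ** Z))"
      by (simp add: TT[symmetric] inner_add_right)
    finally show ?thesis by (simp add: inner_matrix_mult_left[of Z])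
  qed
  have "(W ** T) \<bullet> (A ** (W ** T)) = (X ** T) \<bullet> (A ** (X ** T)) - \<mu> * ((X ** T) \<bullet> (A ** Z))
     - \<mu> * (Z \<bullet> (A ** (X ** T))) + \<mu>\<^sup>2 * (Z \<bullet> (A ** Z))"
    by (simp add: W_def Z_def matrix_diff_rdistrib matrix_diff_ldistrib inner_diff_left inner_diff_right
        matrix_scalar_ac scalar_matrix_assoc[symmetric] power2_eq_square algebra_simps)
  hence diff: "(W ** T) \<bullet> (A ** (W ** T)) - X \<bullet> (A ** X)
     = 2 * \<mu> * (Z \<bullet> Z) + \<mu>\<^sup>2 * (Z \<bullet> (A ** Z) - (Z ** B) \<bullet> Z)"
    by (simp add: XAX XAZ ZAX BI algebra_simps)
  have ZAZ: "b * (Z \<bullet> Z) \<le> Z \<bullet> (A ** Z)"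
    by (rule quadratic_form_columns_ge) (rule lower)
  have ZBZ: "(Z ** B) \<bullet> Z \<le> a * (Z \<bullet> Z)"
    unfolding B_def by (rule form_rows_upper[OF X])
  have "- ((a - b) * (Z \<bullet> Z)) \<le> Z \<bullet> (A ** Z) - (Z ** B) \<bullet> Z"
    using ZAZ ZBZ by (simp add: algebra_simps)
  hence "\<mu>\<^sup>2 * - ((a - b) * (Z \<bullet> Z)) \<le> \<mu>\<^sup>2 * (Z \<bullet> (A ** Z) - (Z ** B) \<bullet> Z)"
    by (intro mult_left_mono) auto
  with diff have lower_bound: "2 * \<mu> * (Z \<bullet> Z) - \<mu>\<^sup>2 * ((a - b) * (Z \<bullet> Z))
      \<le> (W ** T) \<bullet> (A ** (W ** T)) - X \<bullet> (A ** X)" by simp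
  \<comment> \<open>Undo the normalization through \<open>G = Z ** S\<close> and bound
    \<open>transpose G ** G\<close> by the spectral norm estimate for the gradient.\<close>
  have GZ: "G \<bullet> G \<le> (1 + \<mu>\<^sup>2 * ((a - b)\<^sup>2 / 4)) * (Z \<bullet> Z)"
  proof -
    have "G = Z ** S" by (simp add: Z_def matrix_mul_assoc[symmetric] TS)
    hence "G \<bullet> G = (Z ** M) \<bullet> Z"
      by (simp add: inner_matrix_mult_right[of Z S] Ssym S(2)[symmetric] matrix_mul_assoc inner_commute)
    also have "\<dots> = Z \<bullet> Z + \<mu>\<^sup>2 * ((Z ** (transpose G ** G)) \<bullet> Z)"
      by (simp add: M_def matrix_add_ldistrib matrix_scalar_ac scalar_matrix_assoc[symmetric] inner_add_left)
    finally have eq: "G \<bullet> G = Z \<bullet> Z + \<mu>\<^sup>2 * ((Z ** (transpose G ** G)) \<bullet> Z)" .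
    have "(Z ** (transpose G ** G)) \<bullet> Z = transpose Z \<bullet> (transpose G ** G ** transpose Z)"
      by (rule quadratic_form_rows) (simp add: matrix_transpose_mul)
    also have "\<dots> \<le> ((a - b)\<^sup>2 / 4) * (transpose Z \<bullet> transpose Z)"
    proof (rule quadratic_form_columns_le)
      fix j
      show "column j (transpose Z) \<bullet> (transpose G ** G *v column j (transpose Z))
        \<le> ((a - b)\<^sup>2 / 4) * (column j (transpose Z) \<bullet> column j (transpose Z))"
        using gradient_bound[OF X, of "column j (transpose Z)"]
          quadratic_form_mult[of "column j (transpose Z)" G "mat 1"]
        by (simp add: G_def)
    qed
    finally have "\<mu>\<^sup>2 * ((Z ** (transpose G ** G)) \<bullet> Z) \<le> \<mu>\<^sup>2 * ((a - b)\<^sup>2 / 4 * (Z \<bullet> Z))"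
      by (intro mult_left_mono) (simp_all add: inner_transpose)
    thus ?thesis unfolding eq by (simp add: distrib_right mult.assoc)
  qed
  assume \<mu>: "\<mu> = 1 / (a - b)"
  have \<mu>L: "\<mu> * (a - b) = 1" using L by (simp add: \<mu>)
  have "\<mu>\<^sup>2 * (a - b)\<^sup>2 = 1" by (simp add: \<mu>L power_mult_distrib[symmetric])
  \<comment> \<open>The factor is \<open>1 + 1/4 = 5/4\<close> for this step size.\<close>
  with GZ have "4 / 5 * (G \<bullet> G) \<le> Z \<bullet> Z" by simp
  hence "\<mu> * (4 / 5 * (G \<bullet> G)) \<le> \<mu> * (Z \<bullet> Z)"
    using L by (intro mult_left_mono) (auto simp: \<mu>)
  moreover have "\<mu>\<^sup>2 * ((a - b) * (Z \<bullet> Z)) = \<mu> * (Z \<bullet> Z)"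
  proof -
    have "\<mu>\<^sup>2 * ((a - b) * (Z \<bullet> Z)) = \<mu> * (\<mu> * (a - b)) * (Z \<bullet> Z)"
      by (simp only: power2_eq_square mult.assoc)
    thus ?thesis by (simp only: \<mu>L mult_1_right)
  qed
  ultimately have "\<mu> * (4 / 5 * (G \<bullet> G)) \<le> (W ** T) \<bullet> (A ** (W ** T)) - X \<bullet> (A ** X)"
    using lower_bound by linarith
  moreover have "2 / (5 * (a - b)) * (G \<bullet> G) = \<mu> * (4 / 5 * (G \<bullet> G)) / 2"
    using L by (simp add: \<mu> divide_simps)
  ultimately show "\<phi> A (line_point A X \<mu>) \<le> \<phi> A X - 2 / (5 * (a - b)) * (grad_\<phi> A X \<bullet> grad_\<phi> A X)"
    unfolding lp \<phi>_eq_inner G_def[symmetric] by linarith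
qed

section \<open>Comparison with the principal angles\<close>

text \<open>The eigenvalues \<open>d i\<close> of \<open>transpose C ** C\<close> are the squared
  cosines of the principal angles, so the defect is the sum of their squared sines, and the sine of
  an angle never exceeds the angle in absolute value.\<close>

lemma defect_le_dist:
  fixes X :: "real^'p^'n"
  assumes X: "orthonormal_columns X"
  shows "defect X \<le> (grassmann_dist X V)\<^sup>2"
proof -
  define C where "C = transpose V ** X"
  have "transpose (transpose C ** C) = transpose C ** C"
    by (simp add: matrix_transpose_mul)
  then obtain Q :: "real^'p^'p" and d where Q: "transpose Q ** Q = mat 1" "Q ** transpose Q = mat 1"
      "transpose C ** C = Q ** diag_matrix d ** transpose Q"
    using symmetric_matrix_diagonalization by blast
  \<comment> \<open>Each \<open>d i\<close> is the squared norm of the image under \<open>C\<close>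
    of a unit vector, and \<open>C\<close> is a contraction. This places \<open>sqrt (d i)\<close>
    where \<open>cos\<close> inverts \<open>arccos\<close>.\<close>
  have d: "0 \<le> d i" "d i \<le> 1" for i
  proof -
    have "transpose Q ** (transpose C ** C) ** Q = (transpose Q ** Q) ** diag_matrix d ** (transpose Q ** Q)"
      unfolding Q(3) by (simp only: matrix_mul_assoc)
    hence "transpose (C ** Q) ** (C ** Q) = diag_matrix d"
      by (simp add: Q(1) matrix_transpose_mul matrix_mul_assoc)
    moreover have "(transpose (C ** Q) ** (C ** Q)) $ i $ i = (C *v column i Q) \<bullet> (C *v column i Q)"
      by (simp add: matrix_mult_transpose_dot_column column_matrix_mult)
    ultimately have eq: "d i = (C *v column i Q) \<bullet> (C *v column i Q)"
      by (simp add: diag_matrix_def)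
    have "(transpose Q ** Q) $ i $ i = column i Q \<bullet> column i Q"
      by (simp add: matrix_mult_transpose_dot_column)
    hence "column i Q \<bullet> column i Q = 1" by (simp add: Q(1) mat_def)
    hence "d i \<le> 1"
      using norm_split[OF X, of "column i Q"] inner_ge_zero[of "resid X *v column i Q"]
      unfolding eq C_def by linarith
    thus "0 \<le> d i" "d i \<le> 1" by (simp_all add: eq)
  qed
  have "C \<bullet> C = trace (transpose C ** C)" by (simp add: trace_transpose_mult)
  also have "\<dots> = trace (transpose Q ** (Q ** diag_matrix d))"
    unfolding Q(3) by (rule trace_mul_sym)
  also have "\<dots> = (\<Sum>i\<in>UNIV. d i)"
    by (simp add: matrix_mul_assoc Q(1)) (simp add: trace_def diag_matrix_def)
  finally have CC: "C \<bullet> C = (\<Sum>i\<in>UNIV. d i)" .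
  have "defect X = (\<Sum>i\<in>UNIV. 1 - d i)"
    using defect_eq[OF X] CC by (simp add: C_def sum_subtractf)
  also have "\<dots> \<le> (\<Sum>i\<in>UNIV. (arccos (sqrt (d i)))\<^sup>2)"
  proof (rule sum_mono)
    fix i
    have "0 \<le> sqrt (d i)" "sqrt (d i) \<le> 1" using d[of i] by auto
    hence "cos (arccos (sqrt (d i))) = sqrt (d i)" by (intro cos_arccos) linarith+
    hence "1 - d i = (sin (arccos (sqrt (d i))))\<^sup>2"
      using d[of i] by (simp add: sin_squared_eq)
    also have "\<dots> \<le> (arccos (sqrt (d i)))\<^sup>2"
      by (metis abs_sin_x_le_abs_x abs_le_square_iff)
    finally show "1 - d i \<le> (arccos (sqrt (d i)))\<^sup>2" .
  qed
  also have "\<dots> = (grassmann_dist X V)\<^sup>2"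
    unfolding grassmann_dist_def principal_angles_def singular_values_def C_def[symmetric] Q(3)
      eigenvalues_diagonalized[OF Q(2)]
    by (simp add: image_mset.compositionality o_def sum_list_sorted_list_of_multiset sum_nonneg)
  finally show ?thesis .
qed

section \<open>Linear convergence\<close>

lemma rgd_step_contraction:
  fixes X :: "real^'p^'n"
  assumes X: "orthonormal_columns X" and step: "rgd_step A X X'" and D: "excess X \<le> c_Q * (l - m)"
  shows "orthonormal_columns X'" "excess X' \<le> (1 - c_Q * (2 * (l - m) / (5 * (a - b)))) * excess X"
proof -
  have L: "a - b > 0" using gap bm la by linarith
  \<comment> \<open>The bound \<open>c_Q \<le> 2/9\<close> gives \<open>defect X \<le> 4/9\<close>,
    hence \<open>2 (1 - defect X) \<ge> 10/9\<close>, which exceeds \<open>c_Q\<close>.\<close>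
  have "3 * 3 < pi * pi" using pi_gt3 by (intro mult_strict_mono) auto
  hence cQ: "0 < c_Q" "c_Q \<le> 2 / 9" by (simp_all add: c_Q_def power2_eq_square field_simps)
  have "(l - m) * (2 * c_Q) = 2 * (c_Q * (l - m))" by simp
  hence "(l - m) * defect X \<le> (l - m) * (2 * c_Q)"
    using excess_lower[OF X] D by linarith
  hence s: "defect X \<le> 2 * c_Q" using gap by simp
  have "c_Q * ((l - m) * excess X) \<le> (2 * (1 - defect X)) * ((l - m) * excess X)"
    using s cQ gap excess_nonneg[OF X] by (intro mult_right_mono) auto
  also have "\<dots> = 2 * (l - m) * (1 - defect X) * excess X"
    by (simp only: mult.assoc mult.left_commute mult.commute)
  also have "\<dots> \<le> grad_\<phi> A X \<bullet> grad_\<phi> A X"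
    using s cQ by (intro gradient_domination X) auto
  finally have PL: "c_Q * ((l - m) * excess X) \<le> grad_\<phi> A X \<bullet> grad_\<phi> A X" .
  have "orthonormal_columns X' \<and> excess X' \<le> excess X - 2 / (5 * (a - b)) * (grad_\<phi> A X \<bullet> grad_\<phi> A X)"
  proof (cases "grad_\<phi> A X = 0")
    case True
    thus ?thesis using step X by (simp add: rgd_step_def)
  next
    case False
    then obtain \<mu>' where \<mu>': "X' = line_point A X \<mu>'"
      "\<And>\<mu>. \<mu> \<ge> 0 \<Longrightarrow> \<phi> A (line_point A X \<mu>') \<le> \<phi> A (line_point A X \<mu>)"
      using step by (auto simp: rgd_step_def)
    \<comment> \<open>The exact minimizer is at least as good as the fixed step size
      \<open>1 / (a - b)\<close>.\<close>
    have "\<phi> A X' \<le> \<phi> A (line_point A X (1 / (a - b)))"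
      unfolding \<mu>'(1) using L by (intro \<mu>'(2)) simp
    with line_point_decrease[OF X] show ?thesis
      unfolding excess_def \<mu>'(1) by fastforce
  qed
  moreover have "2 / (5 * (a - b)) * (c_Q * ((l - m) * excess X)) \<le> 2 / (5 * (a - b)) * (grad_\<phi> A X \<bullet> grad_\<phi> A X)"
    using PL L by (intro mult_left_mono) auto
  moreover have "(1 - c_Q * (2 * (l - m) / (5 * (a - b)))) * excess X
      = excess X - 2 / (5 * (a - b)) * (c_Q * ((l - m) * excess X))"
    by (simp add: left_diff_distrib)
  ultimately show "orthonormal_columns X'" "excess X' \<le> (1 - c_Q * (2 * (l - m) / (5 * (a - b)))) * excess X"
    by auto
qed

text \<open>The smallness condition of the contraction step concerns the excess, not the distance.
  As the factor lies in \<open>[0, 1]\<close>, the excess never rises above its initial value, so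
  the condition holds at every iterate.\<close>

lemma rgd_iterates_convergence:
  fixes X :: "nat \<Rightarrow> real^'p^'n"
  assumes X0: "orthonormal_columns X0" and close: "(grassmann_dist X0 V)\<^sup>2 \<le> 2 * c_Q * (l - m) / (a - b)"
    and iter: "rgd_iterates A X0 X"
  shows "excess (X k) \<le> (1 - c_Q * (2 * (l - m) / (5 * (a - b)))) ^ k * excess X0"
proof -
  define r where "r = 1 - c_Q * (2 * (l - m) / (5 * (a - b)))"
  have L: "a - b > 0" using gap bm la by linarith
  have "3 * 3 < pi * pi" using pi_gt3 by (intro mult_strict_mono) auto
  hence cQ: "0 < c_Q" "c_Q \<le> 2 / 9" by (simp_all add: c_Q_def power2_eq_square field_simps)
  have r: "0 \<le> r" "r \<le> 1"
  proof -
    have q: "0 \<le> 2 * (l - m) / (5 * (a - b))" "2 * (l - m) / (5 * (a - b)) \<le> 1"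
      using gap bm la L by (simp_all add: field_simps)
    hence "c_Q * (2 * (l - m) / (5 * (a - b))) \<le> 1 * 1"
      using cQ by (intro mult_mono) auto
    moreover have "0 \<le> c_Q * (2 * (l - m) / (5 * (a - b)))"
      using q(1) cQ by (intro mult_nonneg_nonneg) auto
    ultimately show "0 \<le> r" "r \<le> 1" by (simp_all add: r_def)
  qed
  \<comment> \<open>The distance enters only here: twice the excess is at most \<open>a - b\<close>
    times the defect, and the defect is at most the squared distance.\<close>
  have "2 * excess X0 \<le> (a - b) * (2 * c_Q * (l - m) / (a - b))"
    using excess_upper[OF X0] defect_le_dist[OF X0] close L
    by (meson mult_left_mono order.trans less_imp_le)
  hence D0: "excess X0 \<le> c_Q * (l - m)" using L by simp
  have "orthonormal_columns (X k) \<and> excess (X k) \<le> r ^ k * excess X0"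
  proof (induction k)
    case 0
    thus ?case using iter X0 by (simp add: rgd_iterates_def)
  next
    case (Suc k)
    have "r ^ k * excess X0 \<le> 1 * excess X0"
      using r excess_nonneg[OF X0] by (intro mult_right_mono power_le_one) auto
    hence "excess (X k) \<le> c_Q * (l - m)" using Suc D0 by linarith
    moreover have "rgd_step A (X k) (X (Suc k))" using iter by (simp add: rgd_iterates_def)
    ultimately have "orthonormal_columns (X (Suc k))" "excess (X (Suc k)) \<le> r * excess (X k)"
      using rgd_step_contraction Suc unfolding r_def by blast+
    moreover have "r * excess (X k) \<le> r * (r ^ k * excess X0)"
      using Suc r by (intro mult_left_mono) auto
    ultimately show ?case by simp
  qed
  thus ?thesis by (simp add: r_def)
qed

end

section \<open>From ordered eigenvalues to the spectral gap\<close>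

lemma projection_onto_columns:
  fixes V :: "real^'p^'n"
  assumes V: "orthonormal_columns V" and u: "u \<in> span (columns V)"
  shows "V *v (transpose V *v u) = u"
  using u
proof (induction rule: span_induct)
  case base
  show ?case
    unfolding matrix_vector_mul_assoc
    by (auto simp: subspace_def matrix_vector_right_distrib matrix_vector_mult_scaleR)
next
  case (step x)
  then obtain j where "x = column j V" by (auto simp: columns_def)
  hence "V *v (transpose V *v x) = column j (V ** (transpose V ** V))"
    by (simp only: column_matrix_mult)
  thus ?case using V \<open>x = column j V\<close> by (simp add: orthonormal_columns_def)
qed

text \<open>Each of the four bounds is an extremal value of the form of \<open>A\<close> on an
  invariant subspace: the whole space, the span of \<open>V\<close>, or its orthogonal complement.
  It is attained at an eigenvector, so it is some \<open>lam i\<close>, and the subspace restricts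
  the index \<open>i\<close>.\<close>

lemma spectral_gap_intro:
  fixes A :: "real^'n^'n" and V :: "real^'p^'n" and lam :: "nat \<Rightarrow> real" and n p :: nat
  assumes sym: "transpose A = A"
    and ev: "image_mset lam (mset_set {1..n}) = eigenvalues A"
    and dec: "antimono_on {1..n} lam" and p: "1 \<le> p" "p < n"
    and gap: "lam (p + 1) < lam p"
    and V: "orthonormal_columns V"
    and V_inv: "span (columns V) = span {v. \<exists>i\<in>{1..p}. A *v v = lam i *\<^sub>R v}"
  shows "spectral_gap A V (lam 1) (lam n) (lam p) (lam (p + 1))"
proof -
  define E where "E = {v. \<exists>i\<in>{1..p}. A *v v = lam i *\<^sub>R v}"
  define U where "U = span (columns V)"
  have UE: "U = span E" using V_inv by (simp add: U_def E_def)
  have dec': "lam j \<le> lam i" if "1 \<le> i" "i \<le> j" "j \<le> n" for i j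
    using monotone_onD[OF dec, of i j] that by auto
  \<comment> \<open>Minima are obtained by applying the maximum principle to the negated
    map.\<close>
  have lin: "linear ((*v) A)" "linear (\<lambda>x. - (A *v x))"
    by (auto intro: linear_compose_neg)
  have sa: "(A *v x) \<bullet> y = x \<bullet> (A *v y)" for x y
    using inner_transpose_matrix_vector[of A x y] sym by simp
  have sa_neg: "- (A *v x) \<bullet> y = x \<bullet> - (A *v y)" for x y
    by (simp add: sa)
  have lam_ev: "\<exists>i\<in>{1..n}. lam i = m" if "A *v v = m *\<^sub>R v" "v \<noteq> 0" for v m
  proof -
    have "eigenvalues A \<noteq> {#}" using p by (auto simp: ev[symmetric] mset_set_empty_iff)
    from eigenvalue_in_eigenvalues[OF that this] show ?thesis by (auto simp: ev[symmetric])
  qed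
  have AU: "A *v u \<in> U" if "u \<in> U" for u
    using that unfolding UE
  proof (induction rule: span_induct)
    case base
    show ?case
      by (auto simp: subspace_def matrix_vector_right_distrib matrix_vector_mult_scaleR
          span_zero span_add span_scale)
  next
    case (step x)
    then obtain i where "A *v x = lam i *\<^sub>R x" by (auto simp: E_def)
    thus ?case using step by (auto intro: span_scale span_base)
  qed
  have inv: "A ** V = V ** (transpose V ** A ** V)"
  proof -
    have "column j (A ** V) = column j (V ** (transpose V ** A ** V))" for j
    proof -
      have "column j V \<in> U" by (auto simp: U_def columns_def intro: span_base)
      from projection_onto_columns[OF V AU[OF this, unfolded U_def]]
      show ?thesis by (simp only: column_matrix_mult matrix_vector_mul_assoc matrix_mul_assoc)
    qed
    thus ?thesis by (simp add: column_def vec_eq_iff)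
  qed
  show ?thesis
  proof
    show "transpose A = A" "orthonormal_columns V" "A ** V = V ** (transpose V ** A ** V)"
      "lam (p + 1) < lam p" by fact+
    show "lam n \<le> lam (p + 1)" "lam p \<le> lam 1" using p by (auto intro!: dec')
  next
    fix x :: "real^'n"
    obtain v m where v: "norm v = 1" "A *v v = m *\<^sub>R v" "\<And>x. x \<bullet> (A *v x) \<le> m * (x \<bullet> x)"
      using selfadjoint_max_eigenvector[OF lin(1) sa, of UNIV] by (auto simp: UNIV_not_singleton)
    have "v \<noteq> 0" using v(1) by auto
    then obtain i where "i \<in> {1..n}" "lam i = m" using lam_ev v(2) by blast
    hence "m \<le> lam 1" using dec'[of 1 i] by simp
    hence "m * (x \<bullet> x) \<le> lam 1 * (x \<bullet> x)" by (intro mult_right_mono) auto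
    thus "x \<bullet> (A *v x) \<le> lam 1 * (x \<bullet> x)" using v(3)[of x] by linarith
  next
    fix x :: "real^'n"
    obtain v m where v: "norm v = 1" "- (A *v v) = m *\<^sub>R v" "\<And>x. x \<bullet> - (A *v x) \<le> m * (x \<bullet> x)"
      using selfadjoint_max_eigenvector[OF lin(2) sa_neg, of UNIV] by (auto simp: UNIV_not_singleton)
    have "v \<noteq> 0" using v(1) by auto
    moreover have "A *v v = (- m) *\<^sub>R v" using v(2) by (metis minus_minus scaleR_minus_left)
    ultimately obtain i where "i \<in> {1..n}" "lam i = - m" using lam_ev by blast
    hence "lam n \<le> - m" using dec'[of i n] by simp
    hence "lam n * (x \<bullet> x) \<le> - m * (x \<bullet> x)" by (intro mult_right_mono) auto
    thus "lam n * (x \<bullet> x) \<le> x \<bullet> (A *v x)" using v(3)[of x] by simp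
  next
    fix y :: "real^'p"
    define u where "u = V *v y"
    have u: "u \<in> U" by (simp add: u_def U_def matrix_vector_mult_in_columnspace)
    have "lam p * (u \<bullet> u) \<le> u \<bullet> (A *v u)"
    proof (cases "U = {0}")
      case True thus ?thesis using u by simp
    next
      case False
      have "subspace U" "(\<lambda>x. - (A *v x)) ` U \<subseteq> U"
        using AU by (auto simp: U_def subspace_span intro: span_neg)
      then obtain v m where v: "v \<in> U" "norm v = 1" "- (A *v v) = m *\<^sub>R v"
          "\<And>x. x \<in> U \<Longrightarrow> x \<bullet> - (A *v x) \<le> m * (x \<bullet> x)"
        using selfadjoint_max_eigenvector[OF lin(2) sa_neg _ _ False] by blast
      have vm: "A *v v = (- m) *\<^sub>R v" using v(3) by (metis minus_minus scaleR_minus_left)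
      \<comment> \<open>Eigenvectors for different eigenvalues are orthogonal. Otherwise
        \<open>v\<close> would be orthogonal to all of \<open>E\<close>, hence to its span
        \<open>U\<close>, which contains \<open>v\<close>.\<close>
      have "\<exists>i\<in>{1..p}. lam i = - m"
      proof (rule ccontr)
        assume neq: "\<not> (\<exists>i\<in>{1..p}. lam i = - m)"
        have "orthogonal v e" if e: "e \<in> E" for e
        proof -
          obtain i where i: "i \<in> {1..p}" "A *v e = lam i *\<^sub>R e" using e by (auto simp: E_def)
          have "(lam i - - m) * (v \<bullet> e) = 0"
            using sa[of v e] i(2) vm by (simp add: algebra_simps)
          moreover have "lam i \<noteq> - m" using neq i(1) by blast
          ultimately show ?thesis unfolding orthogonal_def mult_eq_0_iff right_minus_eq by blast
        qed
        from orthogonal_to_span[OF v(1)[unfolded UE] this] have "orthogonal v v" .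
        thus False using v(2) by (auto simp: orthogonal_def)
      qed
      then obtain i where i: "i \<in> {1..p}" "lam i = - m" by blast
      hence "lam p \<le> - m" using dec'[of i p] p by simp
      hence "lam p * (u \<bullet> u) \<le> - m * (u \<bullet> u)" by (intro mult_right_mono) auto
      thus ?thesis using v(4)[OF u] by simp
    qed
    thus "lam p * (y \<bullet> y) \<le> (V *v y) \<bullet> (A *v (V *v y))"
      by (simp add: u_def orthonormal_columns_inner[OF V])
  next
    fix x :: "real^'n" assume x: "transpose V *v x = 0"
    define W where "W = {x. transpose V *v x = 0}"
    have xW: "x \<in> W" using x by (simp add: W_def)
    show "x \<bullet> (A *v x) \<le> lam (p + 1) * (x \<bullet> x)"
    proof (cases "W = {0}")
      case True thus ?thesis using xW by simp
    next
      case False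
      have "subspace W" unfolding W_def by (intro linear_subspace_kernel matrix_vector_mul_linear)
      moreover have "(*v) A ` W \<subseteq> W"
      proof -
        \<comment> \<open>Transposing the invariance equation shows that the orthogonal complement
          is invariant too.\<close>
        have "transpose V ** A = transpose V ** A ** V ** transpose V"
          using arg_cong[OF inv, of transpose] by (simp add: matrix_transpose_mul sym matrix_mul_assoc)
        hence "transpose V *v (A *v z) = transpose V ** A ** V *v (transpose V *v z)" for z
          by (simp only: matrix_vector_mul_assoc matrix_mul_assoc)
        thus ?thesis unfolding W_def by (auto simp del: transpose_matrix_vector)
      qed
      ultimately obtain v m where v: "v \<in> W" "norm v = 1" "A *v v = m *\<^sub>R v"
          "\<And>x. x \<in> W \<Longrightarrow> x \<bullet> (A *v x) \<le> m * (x \<bullet> x)"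
        using selfadjoint_max_eigenvector[OF lin(1) sa _ _ False] by blast
      have "v \<noteq> 0" using v(2) by auto
      then obtain i where i: "i \<in> {1..n}" "lam i = m" using lam_ev v(3) by blast
      \<comment> \<open>An index up to \<open>p\<close> would place \<open>v\<close> in the span of
        \<open>V\<close>, where the projection fixes it; but \<open>transpose V\<close> annihilates
        \<open>v\<close>, so \<open>v\<close> would be 0.\<close>
      have "\<not> i \<le> p"
      proof
        assume "i \<le> p"
        hence "v \<in> E" using i v(3) by (auto simp: E_def)
        hence "v \<in> U" unfolding UE by (rule span_base)
        from projection_onto_columns[OF V this[unfolded U_def]] v(1) have "v = 0"
          unfolding W_def by (simp del: transpose_matrix_vector)
        thus False using \<open>v \<noteq> 0\<close> by simp
      qed
      hence "m \<le> lam (p + 1)" using i dec'[of "p + 1" i] by simp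
      hence "m * (x \<bullet> x) \<le> lam (p + 1) * (x \<bullet> x)" by (intro mult_right_mono) auto
      thus ?thesis using v(4)[OF xW] by linarith
    qed
  qed
qed

theorem theorem8:
  fixes A :: "real^'n^'n"
    and lam :: "nat \<Rightarrow> real"
    and V\<alpha> X0 :: "real^'p^'n"
    and X :: "nat \<Rightarrow> real^'p^'n"
    and n p :: nat
    and \<delta> L :: real
  defines "n \<equiv> CARD('n)"
    and "p \<equiv> CARD('p)"
    and "\<delta> \<equiv> lam p - lam (p + 1)"
    and "L \<equiv> lam 1 - lam n"
  assumes A: "sym_pos_def A"
    and lam_eigenvalues: "image_mset lam (mset_set {1..n}) = eigenvalues A"
    and lam_decreasing: "antimono_on {1..n} lam"
    and p_less_n: "p < n"
    and gap: "\<delta> > 0"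
    and V_orthonormal: "orthonormal_columns V\<alpha>"
    and V_invariant: "span (columns V\<alpha>) = span {v. \<exists>i\<in>{1..p}. A *v v = lam i *\<^sub>R v}"
    and X0_orthonormal: "orthonormal_columns X0"
    and X0_close: "grassmann_dist X0 V\<alpha> \<le> sqrt (2 * c_Q * \<delta> / L)"
    and iterates: "rgd_iterates A X0 X"
  shows "\<forall>k. \<phi> A (X k) - \<phi> A V\<alpha> \<le> (1 - c_Q * (2 * \<delta> / (5 * L))) ^ k * (\<phi> A X0 - \<phi> A V\<alpha>)"
proof -
  \<comment> \<open>Dimensions are cardinalities of types, hence positive.\<close>
  have p1: "1 \<le> p" by (simp add: p_def Suc_leI)
  interpret spectral_gap A V\<alpha> "lam 1" "lam n" "lam p" "lam (p + 1)"
    using A lam_eigenvalues lam_decreasing p1 p_less_n gap V_orthonormal V_invariant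
    by (intro spectral_gap_intro) (auto simp: sym_pos_def_def \<delta>_def)
  have L: "L > 0" using gap bm la by (simp add: L_def \<delta>_def)
  have "0 \<le> grassmann_dist X0 V\<alpha>"
    by (auto simp: grassmann_dist_def intro!: sum_list_nonneg)
  hence "(grassmann_dist X0 V\<alpha>)\<^sup>2 \<le> (sqrt (2 * c_Q * \<delta> / L))\<^sup>2"
    using X0_close by (intro power_mono)
  also have "\<dots> = 2 * c_Q * \<delta> / L"
    using \<open>\<delta> > 0\<close> L by (simp add: c_Q_def)
  finally show ?thesis
    using rgd_iterates_convergence[OF X0_orthonormal _ iterates]
    unfolding excess_def L_def \<delta>_def by blast
qed

end
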